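(* Let $\mathcal L$ be a constant-coefficient linear partial differential operator of order $c$ on $\mathbb R^d$ and let $G$ satisfy $\mathcal LG=0$ on $\mathbb R^d\setminus\{\boldsymbol 0\}$. Let $p\ge c$, and assume that there are constants $a,M_0>0$ and $p'\in\mathbb R$ with $p'\ge-p$ such that $$|\partial^{\boldsymbol q}G(\boldsymbol x)|\le\frac{M_0}{\|\boldsymbol x\|^{|\boldsymbol q|+p'}}\qquad(0<\|\boldsymbol x\|\le a,\ \boldsymbol q\in\mathbb N_0^d,\ |\boldsymbol q|\ge p+1).$$ Assume further that there is a constant $M'$ with $|v_{\boldsymbol k,\boldsymbol s}\,a^{|\boldsymbol k|-|\boldsymbol s|}|<M'$ for all $\boldsymbol k\in\mathcal M(p)$ and $\boldsymbol s\in\boldsymbol\nu(\boldsymbol j)$ (the coefficients $v_{\boldsymbol k,\boldsymbol s}$ are defined in the context). Then there is a constant $A''$ depending on $p$ (and on the fixed data $d,\mathcal L,\boldsymbol\nu,G,a,M_0,M',p'$, but not on $\boldsymbol x,\boldsymbol y,\boldsymbol c_1,\boldsymbol c_2,R_1,R_2$) such that the following holds. Let $\boldsymbol c_1,\boldsymbol c_2,\boldsymbol y\in\mathbb R^d$ and $R_1,R_2>0$ satisfy $\|\boldsymbol y-\boldsymbol c_1\|<R_1$ and $R_2\ge R_1+\|\boldsymbol c_2-\boldsymbol c_1\|$, and put $\boldsymbol h=\boldsymbol c_2-\boldsymbol c_1$. Let $\boldsymbol\alpha$ and $\boldsymbol\beta$ be the coefficients, in uncompressed and in compressed representation respectively,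 of the order-$p$ multipole expansion of the source $\boldsymbol y$ around $\boldsymbol c_1$, and for $n\in\{1,\dots,N(p)\}$ let $$\boldsymbol\rho_n=\sum_{\substack{1\le i\le N(p)\\ \boldsymbol\nu(i)\le\boldsymbol\nu(n)}}\frac{\boldsymbol h^{\boldsymbol\nu(n)-\boldsymbol\nu(i)}}{(\boldsymbol\nu(n)-\boldsymbol\nu(i))!}\boldsymbol\alpha_i,\qquad \boldsymbol\sigma_n=\sum_{\substack{1\le i\le N(p)\\ \boldsymbol\nu(i)\le\boldsymbol\nu(n)}}\frac{\boldsymbol h^{\boldsymbol\nu(n)-\boldsymbol\nu(i)}}{(\boldsymbol\nu(n)-\boldsymbol\nu(i))!}[E\boldsymbol\beta]_i .$$ Then for every $\boldsymbol x\in\mathbb R^d$ with $R_2<\|\boldsymbol x-\boldsymbol c_2\|\le a$, $$\left|\sum_{n=1}^{N(p)}\boldsymbol\sigma_n(\partial^{\boldsymbol\nu(n)}G)(\boldsymbol x-\boldsymbol c_2)-\sum_{n=1}^{N(p)}\boldsymbol\rho_n(\partial^{\boldsymbol\nu(n)}G)(\boldsymbol x-\boldsymbol c_2)\right|\le\frac{A''R_2^{p+1}}{\|\boldsymbol x-\boldsymbol c_2\|^{p+p'}\,(\|\boldsymbol x-\boldsymbol c_2\|-R_2)} .$$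
   Context: Notation. $d\ge1$; for $\boldsymbol q\in\mathbb N_0^d$, $|\boldsymbol q|=\sum_i q_i$, $\boldsymbol q!=\prod_i q_i!$, $\boldsymbol x^{\boldsymbol q}=\prod_i x_i^{q_i}$, $\partial^{\boldsymbol q}=\prod_i\partial_{x_i}^{q_i}$, and $\boldsymbol m\ge\boldsymbol n$, $\boldsymbol n\le\boldsymbol m$ are meant componentwise; $\|\cdot\|$ is the Euclidean norm. $\mathcal M(p)=\{\boldsymbol q\in\mathbb N_0^d:|\boldsymbol q|\le p\}$, $N(p)=|\mathcal M(p)|$. $\mathcal L=\sum_{\boldsymbol m\in\mathcal M(c)}a_{\boldsymbol m}\partial^{\boldsymbol m}$ with $a_{\boldsymbol m}\in\mathbb C$ has order $c\ge1$ ($a_{\boldsymbol m}\ne0$ for some $|\boldsymbol m|=c$). $G:\mathbb R^d\setminus\{\boldsymbol 0\}\to\mathbb C$ is of class $C^{2p}$, and all derivatives appearing in the decay assumption are assumed to exist. Graded monomial ordering: a bijection $\boldsymbol\nu:\mathbb N=\{1,2,\dots\}\to\mathbb N_0^d$ with $\boldsymbol\nu(1)=\boldsymbol 0$; $|\boldsymbol\nu(i)|<|\boldsymbol\nu(j)|\Rightarrow i<j$; and $i<j\Rightarrow\boldsymbol\nu^{-1}(\boldsymbol\nu(i)+\boldsymbol\nu(k))<\boldsymbol\nu^{-1}(\boldsymbol\nu(j)+\boldsymbol\nu(k))$ for all $i,j,k$. Fix one. Compression. Let $P\in\mathbb C^{N(p-c)\times N(p)}$, $P_{i_1,i_2}=b_{\boldsymbol\nu(i_1),\boldsymbol\nu(i_2)}$,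 where $b_{\boldsymbol n,\boldsymbol m}=a_{\boldsymbol m-\boldsymbol n}$ if $\boldsymbol m\ge\boldsymbol n$ and $\boldsymbol m-\boldsymbol n\in\mathcal M(c)$, and $0$ otherwise. Let $h(i)$ be the index of the last nonzero column in row $i$ of $P$, $\bar{\boldsymbol j}=\{h(1),\dots,h(N(p-c))\}$, $\boldsymbol j=\{1,\dots,N(p)\}\setminus\bar{\boldsymbol j}$ and $\boldsymbol\nu(\boldsymbol j)=\{\boldsymbol\nu(i):i\in\boldsymbol j\}$. The submatrix $P_{[:,\bar{\boldsymbol j}]}$ of the columns $\bar{\boldsymbol j}$ is square and invertible. The decompression matrix $M$, with $N(p)$ rows and columns indexed by $\boldsymbol j$, has $M_{[\boldsymbol j,:]}=I$ and $M_{[\bar{\boldsymbol j},:]}=-P_{[:,\bar{\boldsymbol j}]}^{-1}P_{[:,\boldsymbol j]}$. The coefficients $v_{\boldsymbol k,\boldsymbol s}$ ($\boldsymbol k\in\mathcal M(p)$, $\boldsymbol s\in\boldsymbol\nu(\boldsymbol j)$) are the entries of $M$ in row $\boldsymbol\nu^{-1}(\boldsymbol k)$ and column $\boldsymbol\nu^{-1}(\boldsymbol s)$, so that $\partial^{\boldsymbol k}G=\sum_{\boldsymbol s\in\boldsymbol\nu(\boldsymbol j)}v_{\boldsymbol k,\boldsymbol s}\,\partial^{\boldsymbol s}G$; they vanish when $|\boldsymbol s|>|\boldsymbol k|$. The order-$p$ multipole expansion of the source $\boldsymbol y$ around $\boldsymbol c_1$ has uncompressed coefficients $\boldsymbol\alpha_i=(\boldsymbol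 c_1-\boldsymbol y)^{\boldsymbol\nu(i)}/\boldsymbol\nu(i)!$, $1\le i\le N(p)$, and compressed coefficients $\boldsymbol\beta=M^T\boldsymbol\alpha=(\boldsymbol\beta_i)_{i\in\boldsymbol j}$. The embedding $E$ is defined by $[E\boldsymbol\beta]_i=\boldsymbol\beta_i$ for $i\in\boldsymbol j$ and $[E\boldsymbol\beta]_i=0$ for $i\in\{1,\dots,N(p)\}\setminus\boldsymbol j$. *)

theory Defs
  imports "HOL-Analysis.Analysis"
begin

type_synonym 'd multi_index = "nat ^ 'd"

definition mdeg :: "'d::finite multi_index \<Rightarrow> nat" where
  "mdeg q = (\<Sum>i\<in>UNIV. q $ i)"

definition mfact :: "'d::finite multi_index \<Rightarrow> nat" where
  "mfact q = (\<Prod>i\<in>UNIV. fact (q $ i))"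

definition mpow :: "real ^ 'd \<Rightarrow> 'd::finite multi_index \<Rightarrow> real" where
  "mpow x q = (\<Prod>i\<in>UNIV. (x $ i) ^ (q $ i))"

definition multi_indices :: "nat \<Rightarrow> 'd::finite multi_index set" where
  "multi_indices p = {q. mdeg q \<le> p}"

definition multi_count :: "'d::finite itself \<Rightarrow> nat \<Rightarrow> nat" where
  "multi_count _ p = card (multi_indices p :: 'd multi_index set)"


definition partial :: "'d \<Rightarrow> (real ^ 'd \<Rightarrow> complex) \<Rightarrow> real ^ 'd::finite \<Rightarrow> complex" where
  "partial i f x = vector_derivative (\<lambda>t. f (x + t *\<^sub>R axis i 1)) (at 0)"

fun partials :: "'d list \<Rightarrow> (real ^ 'd \<Rightarrow> complex) \<Rightarrow> real ^ 'd::finite \<Rightarrow> complex" where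
  "partials [] f = f"
| "partials (i # ds) f = partial i (partials ds f)"

text \<open>Since \<^const>\<open>vector_derivative\<close> is total, existence is recorded separately: the inner
  derivative has to exist at all points near \<open>x\<close> on the line through \<open>x\<close> in the direction of
  the outer one, and to be differentiable there.\<close>

fun partials_exist_at :: "'d list \<Rightarrow> (real ^ 'd \<Rightarrow> complex) \<Rightarrow> real ^ 'd::finite \<Rightarrow> bool" where
  "partials_exist_at [] f x \<longleftrightarrow> True"
| "partials_exist_at (i # ds) f x \<longleftrightarrow>
     (\<forall>\<^sub>F t in nhds 0. partials_exist_at ds f (x + t *\<^sub>R axis i 1)) \<and>
     (\<lambda>t. partials ds f (x + t *\<^sub>R axis i 1)) differentiable (at 0)"

text \<open>Meant for open sets \<open>S\<close>.\<close>

definition Ck_on :: "nat \<Rightarrow> (real ^ 'd::finite \<Rightarrow> complex) \<Rightarrow> (real ^ 'd) set \<Rightarrow> bool" where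
  "Ck_on k f S \<longleftrightarrow> (\<forall>ds. length ds \<le> k \<longrightarrow>
     (\<forall>x\<in>S. partials_exist_at ds f x) \<and> continuous_on S (partials ds f))"

text \<open>The product of the powers of the \<open>\<partial>\<^sub>i\<close> is taken in the order of a fixed enumeration
  \<open>x\<^sub>1, \<dots>, x\<^sub>d\<close> of the coordinates; for functions of class \<open>C\<^sup>k\<close> with \<open>k\<close> at least the degree
  of the multi-index, the order is irrelevant.\<close>

definition coordinates :: "'d::finite list" where
  "coordinates = (SOME ds. distinct ds \<and> set ds = UNIV)"

definition directions :: "'d::finite multi_index \<Rightarrow> 'd list" where
  "directions q = concat (map (\<lambda>i. replicate (q $ i) i) coordinates)"

definition multi_deriv ::
    "'d::finite multi_index \<Rightarrow> (real ^ 'd \<Rightarrow> complex) \<Rightarrow> real ^ 'd \<Rightarrow> complex" where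
  "multi_deriv q f = partials (directions q) f"

definition multi_deriv_exists_at ::
    "'d::finite multi_index \<Rightarrow> (real ^ 'd \<Rightarrow> complex) \<Rightarrow> real ^ 'd \<Rightarrow> bool" where
  "multi_deriv_exists_at q f x = partials_exist_at (directions q) f x"

text \<open>A constant-coefficient operator is given by its order \<open>c\<close> and its coefficients \<open>L\<close>, of which
  only those on \<^term>\<open>multi_indices c\<close> are used.\<close>

definition has_order :: "('d::finite multi_index \<Rightarrow> complex) \<Rightarrow> nat \<Rightarrow> bool" where
  "has_order L c \<longleftrightarrow> (\<exists>m. mdeg m = c \<and> L m \<noteq> 0)"

definition diff_op :: "('d::finite multi_index \<Rightarrow> complex) \<Rightarrow> nat \<Rightarrow>
    (real ^ 'd \<Rightarrow> complex) \<Rightarrow> real ^ 'd \<Rightarrow> complex" where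
  "diff_op L c f x = (\<Sum>m\<in>multi_indices c. L m * multi_deriv m f x)"


text \<open>All indices start at 1; the value \<open>\<nu> 0\<close> is irrelevant.\<close>

definition position :: "(nat \<Rightarrow> 'd::finite multi_index) \<Rightarrow> 'd multi_index \<Rightarrow> nat" where
  "position \<nu> = inv_into {1..} \<nu>"

definition graded_monomial_ordering :: "(nat \<Rightarrow> 'd::finite multi_index) \<Rightarrow> bool" where
  "graded_monomial_ordering \<nu> \<longleftrightarrow>
     bij_betw \<nu> {1..} UNIV \<and>
     \<nu> 1 = 0 \<and>
     (\<forall>i\<ge>1. \<forall>j\<ge>1. mdeg (\<nu> i) < mdeg (\<nu> j) \<longrightarrow> i < j) \<and>
     (\<forall>i\<ge>1. \<forall>j\<ge>1. \<forall>k\<ge>1. i < j \<longrightarrow> position \<nu> (\<nu> i + \<nu> k) < position \<nu> (\<nu> j + \<nu> k))"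

text \<open>Matrices are functions of a row and a column index, with finite row and column index sets
  given separately. The inverse is unique on \<open>J \<times> I\<close> whenever it exists.\<close>

definition matrix_inv_on :: "'i set \<Rightarrow> 'j set \<Rightarrow> ('i \<Rightarrow> 'j \<Rightarrow> complex) \<Rightarrow> 'j \<Rightarrow> 'i \<Rightarrow> complex" where
  "matrix_inv_on I J A = (SOME B.
     (\<forall>i\<in>I. \<forall>i'\<in>I. (\<Sum>j\<in>J. A i j * B j i') = of_bool (i = i')) \<and>
     (\<forall>j\<in>J. \<forall>j'\<in>J. (\<Sum>i\<in>I. B j i * A i j') = of_bool (j = j')))"

definition b_coeff :: "('d::finite multi_index \<Rightarrow> complex) \<Rightarrow> nat \<Rightarrow>
    'd multi_index \<Rightarrow> 'd multi_index \<Rightarrow> complex" where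
  "b_coeff L c n m = (if n \<le> m \<and> m - n \<in> multi_indices c then L (m - n) else 0)"

definition P_mat :: "('d::finite multi_index \<Rightarrow> complex) \<Rightarrow> nat \<Rightarrow> (nat \<Rightarrow> 'd multi_index) \<Rightarrow>
    nat \<Rightarrow> nat \<Rightarrow> complex" where
  "P_mat L c \<nu> i\<^sub>1 i\<^sub>2 = b_coeff L c (\<nu> i\<^sub>1) (\<nu> i\<^sub>2)"

definition last_col :: "('d::finite multi_index \<Rightarrow> complex) \<Rightarrow> nat \<Rightarrow> (nat \<Rightarrow> 'd multi_index) \<Rightarrow>
    nat \<Rightarrow> nat \<Rightarrow> nat" where
  "last_col L c \<nu> p i = Max {k \<in> {1..multi_count TYPE('d) p}. P_mat L c \<nu> i k \<noteq> 0}"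

definition j_bar :: "('d::finite multi_index \<Rightarrow> complex) \<Rightarrow> nat \<Rightarrow> (nat \<Rightarrow> 'd multi_index) \<Rightarrow>
    nat \<Rightarrow> nat set" where
  "j_bar L c \<nu> p = last_col L c \<nu> p ` {1..multi_count TYPE('d) (p - c)}"

definition j_set :: "('d::finite multi_index \<Rightarrow> complex) \<Rightarrow> nat \<Rightarrow> (nat \<Rightarrow> 'd multi_index) \<Rightarrow>
    nat \<Rightarrow> nat set" where
  "j_set L c \<nu> p = {1..multi_count TYPE('d) p} - j_bar L c \<nu> p"

definition decomp_mat :: "('d::finite multi_index \<Rightarrow> complex) \<Rightarrow> nat \<Rightarrow> (nat \<Rightarrow> 'd multi_index) \<Rightarrow>
    nat \<Rightarrow> nat \<Rightarrow> nat \<Rightarrow> complex" where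
  "decomp_mat L c \<nu> p i s =
     (if i \<in> j_set L c \<nu> p then of_bool (i = s)
      else - (\<Sum>r = 1..multi_count TYPE('d) (p - c).
               matrix_inv_on {1..multi_count TYPE('d) (p - c)} (j_bar L c \<nu> p) (P_mat L c \<nu>) i r
               * P_mat L c \<nu> r s))"

definition v_coeff :: "('d::finite multi_index \<Rightarrow> complex) \<Rightarrow> nat \<Rightarrow> (nat \<Rightarrow> 'd multi_index) \<Rightarrow>
    nat \<Rightarrow> 'd multi_index \<Rightarrow> 'd multi_index \<Rightarrow> complex" where
  "v_coeff L c \<nu> p k s = decomp_mat L c \<nu> p (position \<nu> k) (position \<nu> s)"


definition multipole :: "(nat \<Rightarrow> 'd::finite multi_index) \<Rightarrow> real ^ 'd \<Rightarrow> real ^ 'd \<Rightarrow>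
    nat \<Rightarrow> complex" where
  "multipole \<nu> y c\<^sub>1 i = of_real (mpow (c\<^sub>1 - y) (\<nu> i) / real (mfact (\<nu> i)))"

definition compress :: "('d::finite multi_index \<Rightarrow> complex) \<Rightarrow> nat \<Rightarrow> (nat \<Rightarrow> 'd multi_index) \<Rightarrow>
    nat \<Rightarrow> (nat \<Rightarrow> complex) \<Rightarrow> nat \<Rightarrow> complex" where
  "compress L c \<nu> p \<alpha> s = (\<Sum>i = 1..multi_count TYPE('d) p. decomp_mat L c \<nu> p i s * \<alpha> i)"

definition embed_coeffs :: "('d::finite multi_index \<Rightarrow> complex) \<Rightarrow> nat \<Rightarrow> (nat \<Rightarrow> 'd multi_index) \<Rightarrow>
    nat \<Rightarrow> (nat \<Rightarrow> complex) \<Rightarrow> nat \<Rightarrow> complex" where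
  "embed_coeffs L c \<nu> p \<beta> i = (if i \<in> j_set L c \<nu> p then \<beta> i else 0)"

definition translate :: "(nat \<Rightarrow> 'd::finite multi_index) \<Rightarrow> nat \<Rightarrow> real ^ 'd \<Rightarrow>
    (nat \<Rightarrow> complex) \<Rightarrow> nat \<Rightarrow> complex" where
  "translate \<nu> p h w n = (\<Sum>i | i \<in> {1..multi_count TYPE('d) p} \<and> \<nu> i \<le> \<nu> n.
     of_real (mpow h (\<nu> n - \<nu> i) / real (mfact (\<nu> n - \<nu> i))) * w i)"

end

theory Submission
  imports Defs
begin

text \<open>
  Why the estimate holds. Put \<open>z = x - c\<^sub>2\<close>, \<open>h = c\<^sub>2 - c\<^sub>1\<close>. Interchanging the sums, translating
  coefficients \<open>w\<close> by \<open>h\<close> and evaluating at \<open>z\<close> gives \<open>\<Sum>\<^sub>q w\<^sub>q T\<^sub>q\<close>, where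
  \<open>T\<^sub>q = \<Sum> h\<^sup>l / l! \<partial>\<^bsup>q + l\<^esup> G(z)\<close>, summed over \<open>|l| \<le> p - |q|\<close>, is a truncated Taylor expansion of
  \<open>\<partial>\<^sup>q G(z + h)\<close> (\<open>sum_translate\<close>). Since the compressed coefficients are
  \<open>\<beta>\<^sub>s = \<Sum>\<^sub>k v\<^bsub>k,s\<^esub> \<alpha>\<^sub>k\<close>, the quantity to be bounded is
  \<open>\<Sum>\<^sub>k \<alpha>\<^sub>k (\<Sum>\<^sub>s v\<^bsub>k,s\<^esub> T\<^sub>s - T\<^sub>k)\<close>.

  Differentiating \<open>\<L>G = 0\<close> and eliminating the pivot derivatives shows
  \<open>\<partial>\<^bsup>k + l\<^esup> G = \<Sum>\<^sub>s v\<^bsub>k,s\<^esub> \<partial>\<^bsup>s + l\<^esup> G\<close> for all \<open>|k|, |l| \<le> p\<close> (\<open>multi_deriv_decompress\<close>).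
  Without truncation the defect \<open>\<Sum>\<^sub>s v\<^bsub>k,s\<^esub> T\<^sub>s - T\<^sub>k\<close> would therefore vanish. The truncation depends
  on \<open>q\<close>, and \<open>v\<^bsub>k,s\<^esub> = 0\<close> unless \<open>|s| \<le> |k|\<close> (\<open>v_eq_0\<close>), so for \<open>|k| + |l| \<le> p\<close> no term
  has been cut off and the contributions cancel. For \<open>|k| + |l| > p\<close> the derivatives
  \<open>\<partial>\<^bsup>s + l\<^esup> G\<close> of order at most \<open>p\<close> survive, and nothing is assumed about their size; but by the
  relation their combination equals \<open>\<partial>\<^bsup>k + l\<^esup> G\<close> minus the terms of order above \<open>p\<close>. So the
  defect is a finite combination of derivatives of order at least \<open>p + 1\<close> only (\<open>taylor_defect\<close>);
  no infinite Taylor series and no convergence question enters.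

  Each of these terms is of size at most a constant times \<open>R\<^sub>2\<^bsup>|k| + |l|\<^esup> r\<^bsup>-(|k| + |l| + p')\<^esup>\<close> with
  \<open>r = \<parallel>z\<parallel>\<close>. For the terms containing \<open>v\<^bsub>k,s\<^esub>\<close> this uses \<open>|v\<^bsub>k,s\<^esub>| \<le> M' a\<^bsup>-(|k| - |s|)\<^esup>\<close> and
  \<open>r \<le> a\<close> (\<open>defect_term_bound\<close>). As \<open>R\<^sub>2 < r\<close> and \<open>|k| + |l| \<ge> p + 1\<close>, this is at most
  \<open>R\<^sub>2\<^bsup>p + 1\<^esup> / (r\<^bsup>p + p'\<^esup> (r - R\<^sub>2))\<close>, and the number of terms depends only on the fixed data.

  The relation between the derivatives rests on two facts: partial derivatives of a \<open>C\<^sup>k\<close> function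
  may be permuted (Schwarz), and the pivot columns of \<open>P\<close> form a triangular matrix, because a
  monomial ordering is compatible with adding multi-indices.
\<close>

section \<open>Symmetry of mixed directional derivatives\<close>

lemma line_derivative_shift:
  fixes g :: "'a::real_normed_vector \<Rightarrow> 'b::real_normed_vector"
  assumes "((\<lambda>t. g ((y + s *\<^sub>R u) + t *\<^sub>R u)) has_vector_derivative D) (at 0)"
  shows "((\<lambda>t. g (y + t *\<^sub>R u)) has_vector_derivative D) (at s)"
proof -
  have "((\<lambda>t. g ((y + s *\<^sub>R u) + t *\<^sub>R u)) \<circ> (\<lambda>t. t - s) has_vector_derivative 1 *\<^sub>R D) (at s)"
    by (rule vector_diff_chain_at) (use assms in \<open>auto intro!: derivative_eq_intros\<close>)
  then show ?thesis
    by (simp add: o_def algebra_simps)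
qed

text \<open>Apply the mean value theorem first in direction \<open>u\<close>, to the difference of \<open>g\<close> along the two
  sides parallel to \<open>u\<close>, and then in direction \<open>v\<close>. The left-hand side is symmetric in \<open>u\<close> and
  \<open>v\<close>, which is what makes the two mixed derivatives comparable.\<close>

lemma second_difference_mean_value:
  fixes g :: "'a::real_normed_vector \<Rightarrow> real"
  assumes S: "\<And>s t. 0 \<le> s \<Longrightarrow> s \<le> h \<Longrightarrow> 0 \<le> t \<Longrightarrow> t \<le> h \<Longrightarrow> x + s *\<^sub>R u + t *\<^sub>R v \<in> S"
    and du: "\<And>y. y \<in> S \<Longrightarrow> ((\<lambda>t. g (y + t *\<^sub>R u)) has_vector_derivative gu y) (at 0)"
    and duv: "\<And>y. y \<in> S \<Longrightarrow> ((\<lambda>t. gu (y + t *\<^sub>R v)) has_vector_derivative guv y) (at 0)"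
    and "h > 0"
  obtains s t where "0 < s" "s < h" "0 < t" "t < h"
    "g (x + h *\<^sub>R u + h *\<^sub>R v) - g (x + h *\<^sub>R u) - g (x + h *\<^sub>R v) + g x
       = h * h * guv (x + s *\<^sub>R u + t *\<^sub>R v)"
proof -
  define \<phi> where "\<phi> = (\<lambda>s. g ((x + h *\<^sub>R v) + s *\<^sub>R u) - g (x + s *\<^sub>R u))"
  have "(\<phi> has_real_derivative gu ((x + h *\<^sub>R v) + s *\<^sub>R u) - gu (x + s *\<^sub>R u)) (at s)"
    if "0 \<le> s" "s \<le> h" for s
  proof -
    have "x + h *\<^sub>R v + s *\<^sub>R u \<in> S" "x + s *\<^sub>R u \<in> S"
      using S[of s h] S[of s 0] that by (simp_all add: add_ac)
    then show ?thesis
      unfolding has_real_derivative_iff_has_vector_derivative \<phi>_def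
      by (intro has_vector_derivative_diff line_derivative_shift[of g, OF du])
  qed
  from MVT2[of 0 h \<phi> "\<lambda>s. gu ((x + h *\<^sub>R v) + s *\<^sub>R u) - gu (x + s *\<^sub>R u)", OF \<open>h > 0\<close> this]
  obtain s where s: "0 < s" "s < h"
    "\<phi> h - \<phi> 0 = h * (gu ((x + h *\<^sub>R v) + s *\<^sub>R u) - gu (x + s *\<^sub>R u))"
    by auto
  have "((\<lambda>t. gu ((x + s *\<^sub>R u) + t *\<^sub>R v)) has_real_derivative guv ((x + s *\<^sub>R u) + t *\<^sub>R v)) (at t)"
    if "0 \<le> t" "t \<le> h" for t
    unfolding has_real_derivative_iff_has_vector_derivative
    by (rule line_derivative_shift[of gu, OF duv]) (use S[of s t] that s in auto)
  from MVT2[of 0 h "\<lambda>t. gu ((x + s *\<^sub>R u) + t *\<^sub>R v)"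
      "\<lambda>t. guv ((x + s *\<^sub>R u) + t *\<^sub>R v)", OF \<open>h > 0\<close> this]
  obtain t where t: "0 < t" "t < h"
    "gu ((x + s *\<^sub>R u) + h *\<^sub>R v) - gu (x + s *\<^sub>R u) = h * guv ((x + s *\<^sub>R u) + t *\<^sub>R v)"
    by auto
  show ?thesis
    by (rule that[OF s(1,2) t(1,2)]) (use s(3) t(3) in \<open>simp add: \<phi>_def add_ac\<close>)
qed

text \<open>The second difference over a small parallelogram is \<open>h\<^sup>2\<close> times either mixed derivative at
  some point of it; shrinking the parallelogram, continuity identifies the two at \<open>x\<close>.\<close>

lemma mixed_derivatives_eq_real:
  fixes g :: "'a::real_normed_vector \<Rightarrow> real"
  assumes "open S" "x \<in> S"
    and du: "\<And>y. y \<in> S \<Longrightarrow> ((\<lambda>t. g (y + t *\<^sub>R u)) has_vector_derivative gu y) (at 0)"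
    and duv: "\<And>y. y \<in> S \<Longrightarrow> ((\<lambda>t. gu (y + t *\<^sub>R v)) has_vector_derivative guv y) (at 0)"
    and dv: "\<And>y. y \<in> S \<Longrightarrow> ((\<lambda>t. g (y + t *\<^sub>R v)) has_vector_derivative gv y) (at 0)"
    and dvu: "\<And>y. y \<in> S \<Longrightarrow> ((\<lambda>t. gv (y + t *\<^sub>R u)) has_vector_derivative gvu y) (at 0)"
    and cont: "continuous_on S guv" "continuous_on S gvu"
  shows "guv x = gvu x"
proof -
  have "\<bar>guv x - gvu x\<bar> \<le> 0"
  proof (rule field_le_epsilon)
    fix e :: real assume "0 < e"
    then have e2: "e / 2 > 0" by simp
    from \<open>open S\<close> \<open>x \<in> S\<close> obtain d0 where d0: "d0 > 0" "ball x d0 \<subseteq> S"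
      by (meson openE)
    have "isCont guv x" "isCont gvu x"
      using cont \<open>open S\<close> \<open>x \<in> S\<close> by (auto simp: continuous_on_eq_continuous_at)
    with e2 obtain d1 d2 where
      d1: "d1 > 0" "\<And>y. dist y x < d1 \<Longrightarrow> dist (guv y) (guv x) < e / 2" and
      d2: "d2 > 0" "\<And>y. dist y x < d2 \<Longrightarrow> dist (gvu y) (gvu x) < e / 2"
      unfolding continuous_at_eps_delta by metis
    define d where "d = min d0 (min d1 d2)"
    \<comment> \<open>The summand 1 keeps the denominator positive when \<open>u = v = 0\<close>.\<close>
    define h where "h = d / (2 * (norm u + norm v + 1))"
    have "d > 0" using d0 d1 d2 by (simp add: d_def)
    have pos: "norm u + norm v + 1 > 0"
      by (rule add_nonneg_pos) simp_all
    have "h > 0" using \<open>d > 0\<close> pos by (simp add: h_def)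
    have near: "dist (x + s *\<^sub>R u + t *\<^sub>R v) x < d" if "0 \<le> s" "s \<le> h" "0 \<le> t" "t \<le> h" for s t
    proof -
      have "dist (x + s *\<^sub>R u + t *\<^sub>R v) x \<le> s * norm u + t * norm v"
        using that norm_triangle_ineq[of "s *\<^sub>R u" "t *\<^sub>R v"] by (simp add: dist_norm add_ac)
      also have "\<dots> \<le> h * norm u + h * norm v"
        using that by (intro add_mono mult_right_mono) auto
      also have "\<dots> \<le> h * (norm u + norm v + 1)"
        using \<open>h > 0\<close> by (simp add: algebra_simps)
      also have "\<dots> = d / 2"
        using pos by (simp add: h_def less_imp_neq[symmetric] del: distrib_left_numeral)
      finally show ?thesis using \<open>d > 0\<close> by simp
    qed
    have inS: "x + s *\<^sub>R u + t *\<^sub>R v \<in> S" if "0 \<le> s" "s \<le> h" "0 \<le> t" "t \<le> h" for s t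
      using near[OF that] d0(2) by (force simp: d_def dist_commute)
    have inS': "x + s *\<^sub>R v + t *\<^sub>R u \<in> S" if "0 \<le> s" "s \<le> h" "0 \<le> t" "t \<le> h" for s t
      using inS[of t s] that by (simp add: add_ac)
    obtain s t where st: "0 < s" "s < h" "0 < t" "t < h"
      "g (x + h *\<^sub>R u + h *\<^sub>R v) - g (x + h *\<^sub>R u) - g (x + h *\<^sub>R v) + g x
         = h * h * guv (x + s *\<^sub>R u + t *\<^sub>R v)"
      using second_difference_mean_value[where g = g, OF inS du duv \<open>h > 0\<close>] by blast
    obtain s' t' where st': "0 < s'" "s' < h" "0 < t'" "t' < h"
      "g (x + h *\<^sub>R v + h *\<^sub>R u) - g (x + h *\<^sub>R v) - g (x + h *\<^sub>R u) + g x
         = h * h * gvu (x + s' *\<^sub>R v + t' *\<^sub>R u)"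
      using second_difference_mean_value[where g = g, OF inS' dv dvu \<open>h > 0\<close>] by blast
    have comm: "x + a *\<^sub>R v + b *\<^sub>R u = x + b *\<^sub>R u + a *\<^sub>R v" for a b
      by (simp add: add_ac)
    have "h * h * guv (x + s *\<^sub>R u + t *\<^sub>R v) = h * h * gvu (x + t' *\<^sub>R u + s' *\<^sub>R v)"
      using st(5) st'(5) unfolding comm by linarith
    then have "guv (x + s *\<^sub>R u + t *\<^sub>R v) = gvu (x + t' *\<^sub>R u + s' *\<^sub>R v)"
      using \<open>h > 0\<close> by simp
    moreover have "dist (guv (x + s *\<^sub>R u + t *\<^sub>R v)) (guv x) < e / 2"
      using near[of s t] st by (intro d1) (auto simp: d_def)
    moreover have "dist (gvu (x + t' *\<^sub>R u + s' *\<^sub>R v)) (gvu x) < e / 2"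
      using near[of t' s'] st' by (intro d2) (auto simp: d_def)
    ultimately show "\<bar>guv x - gvu x\<bar> \<le> 0 + e"
      unfolding dist_real_def by linarith
  qed
  then show ?thesis by simp
qed

text \<open>The mean value theorem is a statement about real functions, so it is applied to the inner
  product of \<open>g\<close> with the difference \<open>w\<close> of the mixed derivatives; the result is \<open>w \<bullet> w = 0\<close>.\<close>

lemma mixed_derivatives_eq:
  fixes g :: "'a::real_normed_vector \<Rightarrow> 'b::real_inner"
  assumes "open S" "x \<in> S"
    and du: "\<And>y. y \<in> S \<Longrightarrow> ((\<lambda>t. g (y + t *\<^sub>R u)) has_vector_derivative gu y) (at 0)"
    and duv: "\<And>y. y \<in> S \<Longrightarrow> ((\<lambda>t. gu (y + t *\<^sub>R v)) has_vector_derivative guv y) (at 0)"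
    and dv: "\<And>y. y \<in> S \<Longrightarrow> ((\<lambda>t. g (y + t *\<^sub>R v)) has_vector_derivative gv y) (at 0)"
    and dvu: "\<And>y. y \<in> S \<Longrightarrow> ((\<lambda>t. gv (y + t *\<^sub>R u)) has_vector_derivative gvu y) (at 0)"
    and cont: "continuous_on S guv" "continuous_on S gvu"
  shows "guv x = gvu x"
proof -
  define w where "w = guv x - gvu x"
  note inner = bounded_linear.has_vector_derivative[OF bounded_linear_inner_left, of _ _ _ w]
  have "guv x \<bullet> w = gvu x \<bullet> w"
    by (rule mixed_derivatives_eq_real[where g = "\<lambda>y. g y \<bullet> w", OF assms(1,2)
          inner[OF du] inner[OF duv] inner[OF dv] inner[OF dvu]])
      (auto intro!: continuous_intros cont)
  then have "w \<bullet> w = 0"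
    by (simp add: w_def inner_diff_left)
  then show ?thesis
    by (simp add: w_def)
qed

section \<open>Iterated partial derivatives as a function of the multi-index\<close>

lemma eventually_line_in_open:
  fixes S :: "'a::real_normed_vector set"
  assumes "open S" "x \<in> S"
  shows "\<forall>\<^sub>F t in nhds 0. x + t *\<^sub>R u \<in> S"
proof -
  have "((\<lambda>t. x + t *\<^sub>R u) \<longlongrightarrow> x + 0 *\<^sub>R u) (nhds 0)"
    by (intro tendsto_intros filterlim_ident)
  then show ?thesis
    using assms by (auto dest: topological_tendstoD)
qed

lemma partial_cong:
  assumes "open S" "x \<in> S" and "\<And>y. y \<in> S \<Longrightarrow> f y = g y"
  shows "partial i f x = partial i g x"
proof -
  have "\<forall>\<^sub>F t in nhds 0. f (x + t *\<^sub>R axis i 1) = g (x + t *\<^sub>R axis i 1)"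
    using eventually_line_in_open[OF assms(1,2), of "axis i 1"]
    by (rule eventually_mono) (rule assms(3))
  then show ?thesis
    unfolding partial_def by (intro vector_derivative_cong_eq) auto
qed

lemma partials_cong:
  assumes "open S" "x \<in> S" and "\<And>y. y \<in> S \<Longrightarrow> f y = g y"
  shows "partials ds f x = partials ds g x"
  using assms(2)
proof (induction ds arbitrary: x)
  case (Cons i ds)
  then show ?case
    by (auto intro: partial_cong[OF \<open>open S\<close>])
qed (use assms(3) in auto)

lemma partial_has_vector_derivative:
  assumes "Ck_on k f S" "length ds < k" "x \<in> S"
  shows "((\<lambda>t. partials ds f (x + t *\<^sub>R axis i 1)) has_vector_derivative partials (i # ds) f x) (at 0)"
proof -
  have "length (i # ds) \<le> k" using assms(2) by simp
  then have "partials_exist_at (i # ds) f x"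
    using assms(1,3) unfolding Ck_on_def by blast
  then show ?thesis
    by (simp add: partial_def vector_derivative_works)
qed

lemma partials_swap:
  assumes C: "Ck_on k f S" and "open S" "x \<in> S" and "length ds + 2 \<le> k"
  shows "partials (i # j # ds) f x = partials (j # i # ds) f x"
proof -
  have "length (i # j # ds) \<le> k" "length (j # i # ds) \<le> k"
    using assms(4) by simp_all
  then have cont: "continuous_on S (partials (i # j # ds) f)" "continuous_on S (partials (j # i # ds) f)"
    using C unfolding Ck_on_def by blast+
  have l: "length ds < k" "length (i # ds) < k" "length (j # ds) < k"
    using assms(4) by simp_all
  note D = partial_has_vector_derivative[OF C]
  show ?thesis
    by (rule mixed_derivatives_eq[OF assms(2,3) D[OF l(1)] D[OF l(3)] D[OF l(1)] D[OF l(2)] cont])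
qed

lemma partials_move_to_front:
  assumes C: "Ck_on k f S" and "open S" "x \<in> S" and "length es + length ds < k"
  shows "partials (es @ i # ds) f x = partials (i # es @ ds) f x"
  using assms(3,4)
proof (induction es arbitrary: x)
  case (Cons e es)
  have "partials ((e # es) @ i # ds) f x = partial e (partials (es @ i # ds) f) x"
    by simp
  also have "\<dots> = partial e (partials (i # es @ ds) f) x"
    using Cons by (intro partial_cong[OF \<open>open S\<close>]) auto
  also have "\<dots> = partials (e # i # es @ ds) f x"
    by simp
  also have "\<dots> = partials (i # e # es @ ds) f x"
    using Cons.prems by (intro partials_swap[OF C \<open>open S\<close>]) auto
  finally show ?case by simp
qed simp

text \<open>Adjacent transpositions generate all permutations: the head of one list is moved to the front
  of the other by repeated swaps, and the tails are handled by induction.\<close>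

lemma partials_permute:
  assumes C: "Ck_on k f S" and "open S" "x \<in> S" and "length ds \<le> k" and "mset ds = mset ds'"
  shows "partials ds f x = partials ds' f x"
  using assms(3-5)
proof (induction ds arbitrary: ds' x)
  case (Cons i ds)
  then have "i \<in> set ds'"
    by (metis list.set_intros(1) set_mset_mset)
  then obtain es fs where ds': "ds' = es @ i # fs"
    by (meson split_list)
  have ms: "mset ds = mset (es @ fs)"
    using Cons.prems(3) by (simp add: ds')
  then have len: "length ds = length es + length fs"
    by (metis length_append size_mset)
  have "partials (i # ds) f x = partial i (partials (es @ fs) f) x"
    using Cons ms by (auto intro!: partial_cong[OF \<open>open S\<close>])
  also have "\<dots> = partials (i # es @ fs) f x"
    by simp
  also have "\<dots> = partials ds' f x"
    unfolding ds' using Cons.prems len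
    by (intro partials_move_to_front[OF C \<open>open S\<close>, symmetric]) auto
  finally show ?case .
qed simp

lemma coordinates: "distinct (coordinates :: 'd::finite list)" "set (coordinates :: 'd list) = UNIV"
proof -
  have "\<exists>ds :: 'd list. distinct ds \<and> set ds = UNIV"
    using finite_distinct_list[OF finite[of UNIV]] by blast
  from someI_ex[OF this] show "distinct (coordinates :: 'd list)" "set (coordinates :: 'd list) = UNIV"
    by (auto simp: coordinates_def)
qed

lemma count_directions: "count (mset (directions q)) i = q $ i"
proof -
  have "count (mset (concat (map (\<lambda>i. replicate (q $ i) i) cs))) i = (if i \<in> set cs then q $ i else 0)"
    if "distinct cs" for cs
    using that by (induction cs) auto
  then show ?thesis
    by (simp add: directions_def coordinates)
qed

lemma length_directions: "length (directions q) = mdeg q"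
  unfolding directions_def mdeg_def
  by (simp add: length_concat o_def sum_list_distinct_conv_sum_set coordinates)

lemma mdeg_add: "mdeg (q + r) = mdeg q + mdeg r"
  by (simp add: mdeg_def sum.distrib)

lemma multi_deriv_add:
  assumes "Ck_on k f S" and "open S" "x \<in> S" and "mdeg q + mdeg r \<le> k"
  shows "multi_deriv (q + r) f x = partials (directions q @ directions r) f x"
  unfolding multi_deriv_def
  by (rule partials_permute[OF assms(1-3)])
    (use assms(4) in \<open>auto simp: length_directions mdeg_add count_directions intro: multiset_eqI\<close>)

text \<open>Linearity has to be proved for iterated derivatives of functions that are themselves
  iterated derivatives of \<open>f\<close>, since only their differentiability is known.\<close>

lemma partials_linear_combination:
  assumes C: "Ck_on k f S" and "open S" "x \<in> S" and "\<And>m. m \<in> A \<Longrightarrow> length ds + length (es m) \<le> k"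
  shows "partials ds (\<lambda>y. \<Sum>m\<in>A. a m * partials (es m) f y) x = (\<Sum>m\<in>A. a m * partials (ds @ es m) f x)"
  using assms(3,4)
proof (induction ds arbitrary: x)
  case (Cons i ds)
  have "partials (i # ds) (\<lambda>y. \<Sum>m\<in>A. a m * partials (es m) f y) x =
        partial i (\<lambda>y. \<Sum>m\<in>A. a m * partials (ds @ es m) f y) x"
    unfolding partials.simps
    by (rule partial_cong[OF \<open>open S\<close> Cons.prems(1)], rule Cons.IH) (use Cons.prems(2) in force)+
  also have "\<dots> = (\<Sum>m\<in>A. a m * partials (i # ds @ es m) f x)"
    unfolding partial_def
  proof (intro vector_derivative_at has_vector_derivative_sum has_vector_derivative_mult_right)
    show "((\<lambda>t. partials (ds @ es m) f (x + t *\<^sub>R axis i 1)) has_vector_derivative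
        partials (i # ds @ es m) f x) (at 0)" if "m \<in> A" for m
      using Cons.prems that by (intro partial_has_vector_derivative[OF C]) fastforce+
  qed
  finally show ?case by simp
qed simp

lemma partials_zero: "partials ds (\<lambda>_. 0) x = 0"
  by (induction ds arbitrary: x) (simp_all add: partial_def)

text \<open>An equation with constant coefficients is inherited by all derivatives of a solution, as far
  as its smoothness permits: \<open>\<partial>\<^sup>q\<close> commutes with the operator.\<close>

lemma diff_op_differentiated:
  assumes C: "Ck_on k f S" and "open S" "x \<in> S"
    and eq: "\<And>y. y \<in> S \<Longrightarrow> diff_op L c f y = 0"
    and "mdeg q + c \<le> k"
  shows "(\<Sum>m\<in>multi_indices c. L m * multi_deriv (q + m) f x) = 0"
proof -
  have deg: "mdeg q + mdeg m \<le> k" if "m \<in> multi_indices c" for m :: "'a multi_index"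
    using that assms(5) by (simp add: multi_indices_def)
  have "(\<Sum>m\<in>multi_indices c. L m * multi_deriv (q + m) f x) =
        (\<Sum>m\<in>multi_indices c. L m * partials (directions q @ directions m) f x)"
    using deg by (simp add: multi_deriv_add[OF assms(1-3)])
  also have "\<dots> = partials (directions q) (\<lambda>y. \<Sum>m\<in>multi_indices c. L m * partials (directions m) f y) x"
    using deg by (intro partials_linear_combination[OF assms(1-3), symmetric])
       (simp add: length_directions)
  also have "\<dots> = partials (directions q) (\<lambda>_. 0) x"
    using eq by (intro partials_cong[OF assms(2,3)]) (simp add: diff_op_def multi_deriv_def)
  finally show ?thesis
    by (simp add: partials_zero)
qed

section \<open>Inverses of triangular matrices\<close>

text \<open>Forward substitution: the last unknown occurs in the last equation only.\<close>

lemma lower_triangular_solve: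
  fixes A :: "nat \<Rightarrow> nat \<Rightarrow> 'a::field"
  assumes "\<And>i. i \<in> {1..n} \<Longrightarrow> A i i \<noteq> 0"
    and "\<And>i k. i \<in> {1..n} \<Longrightarrow> k \<in> {1..n} \<Longrightarrow> i < k \<Longrightarrow> A i k = 0"
  shows "\<exists>x. \<forall>i\<in>{1..n}. (\<Sum>k=1..n. A i k * x k) = b i"
  using assms
proof (induction n)
  case (Suc n)
  have "\<exists>x. \<forall>i\<in>{1..n}. (\<Sum>k=1..n. A i k * x k) = b i"
    using Suc.prems by (intro Suc.IH) auto
  then obtain x where x: "\<And>i. i \<in> {1..n} \<Longrightarrow> (\<Sum>k=1..n. A i k * x k) = b i"
    by blast
  define x' where "x' = x(Suc n := (b (Suc n) - (\<Sum>k=1..n. A (Suc n) k * x k)) / A (Suc n) (Suc n))"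
  have *: "(\<Sum>k=1..n. A i k * x' k) = (\<Sum>k=1..n. A i k * x k)" for i
    by (intro sum.cong) (auto simp: x'_def)
  have "(\<Sum>k=1..Suc n. A i k * x' k) = b i" if "i \<in> {1..Suc n}" for i
  proof (cases "i = Suc n")
    case True
    then show ?thesis
      using Suc.prems(1)[of "Suc n"] by (simp add: *) (simp add: x'_def)
  next
    case False
    then have "i \<in> {1..n}" "A i (Suc n) = 0"
      using that Suc.prems(2)[of i "Suc n"] by auto
    then show ?thesis
      using *[of i] x[of i] by simp
  qed
  then show ?case by blast
qed simp

text \<open>Backward substitution for the transposed system: the last row is the only one with an entry
  in the last column, so \<open>y (Suc n)\<close> is determined first and its multiple of the last row is moved
  to the right-hand side.\<close>

lemma lower_triangular_solve_left:
  fixes A :: "nat \<Rightarrow> nat \<Rightarrow> 'a::field"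
  assumes "\<And>i. i \<in> {1..n} \<Longrightarrow> A i i \<noteq> 0"
    and "\<And>i k. i \<in> {1..n} \<Longrightarrow> k \<in> {1..n} \<Longrightarrow> i < k \<Longrightarrow> A i k = 0"
  shows "\<exists>y. \<forall>k\<in>{1..n}. (\<Sum>i=1..n. y i * A i k) = b k"
  using assms
proof (induction n arbitrary: b)
  case (Suc n)
  define z where "z = b (Suc n) / A (Suc n) (Suc n)"
  have "\<exists>y. \<forall>k\<in>{1..n}. (\<Sum>i=1..n. y i * A i k) = b k - z * A (Suc n) k"
    using Suc.prems by (intro Suc.IH) auto
  then obtain y where y: "\<And>k. k \<in> {1..n} \<Longrightarrow> (\<Sum>i=1..n. y i * A i k) = b k - z * A (Suc n) k"
    by blast
  define y' where "y' = y(Suc n := z)"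
  have *: "(\<Sum>i=1..n. y' i * A i k) = (\<Sum>i=1..n. y i * A i k)" for k
    by (intro sum.cong) (auto simp: y'_def)
  have "(\<Sum>i=1..Suc n. y' i * A i k) = b k" if "k \<in> {1..Suc n}" for k
  proof (cases "k = Suc n")
    case True
    have "(\<Sum>i=1..n. y i * A i (Suc n)) = 0"
      using Suc.prems(2) by (intro sum.neutral) auto
    then show ?thesis
      using Suc.prems(1)[of "Suc n"] True by (simp add: *) (simp add: y'_def z_def)
  next
    case False
    then show ?thesis
      using that y[of k] by (simp add: *) (simp add: y'_def)
  qed
  then show ?case by blast
qed simp

lemma sum_of_bool_mult_left [simp]:
  fixes f :: "'i \<Rightarrow> 'a::semiring_1"
  assumes "finite A"
  shows "(\<Sum>k\<in>A. of_bool (i = k) * f k) = of_bool (i \<in> A) * f i"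
    and "(\<Sum>k\<in>A. f k * of_bool (k = i)) = of_bool (i \<in> A) * f i"
  using assms by (simp_all add: of_bool_def if_distrib[of "\<lambda>c. c * _"] if_distrib[of "\<lambda>c. _ * c"] cong: if_cong)

text \<open>Solving for the unit vectors on both sides gives a right and a left inverse, which coincide
  by associativity.\<close>

lemma lower_triangular_inverse:
  fixes A :: "nat \<Rightarrow> nat \<Rightarrow> 'a::field"
  assumes "\<And>i. i \<in> {1..n} \<Longrightarrow> A i i \<noteq> 0"
    and "\<And>i k. i \<in> {1..n} \<Longrightarrow> k \<in> {1..n} \<Longrightarrow> i < k \<Longrightarrow> A i k = 0"
  shows "\<exists>B. (\<forall>i\<in>{1..n}. \<forall>i'\<in>{1..n}. (\<Sum>k=1..n. A i k * B k i') = of_bool (i = i')) \<and>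
             (\<forall>k\<in>{1..n}. \<forall>k'\<in>{1..n}. (\<Sum>i=1..n. B k i * A i k') = of_bool (k = k'))"
proof -
  have "\<exists>x. \<forall>i\<in>{1..n}. (\<Sum>k=1..n. A i k * x k) = of_bool (i = i')" for i'
    by (rule lower_triangular_solve[OF assms])
  then obtain X where X: "\<And>i i'. i \<in> {1..n} \<Longrightarrow> (\<Sum>k=1..n. A i k * X i' k) = of_bool (i = i')"
    by metis
  have "\<exists>y. \<forall>k'\<in>{1..n}. (\<Sum>i=1..n. y i * A i k') = of_bool (k = k')" for k
    by (rule lower_triangular_solve_left[OF assms])
  then obtain Y where Y: "\<And>k k'. k' \<in> {1..n} \<Longrightarrow> (\<Sum>i=1..n. Y k i * A i k') = of_bool (k = k')"
    by metis
  have YX: "Y k i = X i k" if "k \<in> {1..n}" "i \<in> {1..n}" for k i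
  proof -
    have "Y k i = (\<Sum>j=1..n. Y k j * of_bool (j = i))"
      using that by simp
    also have "\<dots> = (\<Sum>j=1..n. Y k j * (\<Sum>l=1..n. A j l * X i l))"
      using X by (intro sum.cong) auto
    also have "\<dots> = (\<Sum>j=1..n. \<Sum>l=1..n. Y k j * A j l * X i l)"
      by (simp add: sum_distrib_left mult.assoc)
    also have "\<dots> = (\<Sum>l=1..n. \<Sum>j=1..n. Y k j * A j l * X i l)"
      by (rule sum.swap)
    also have "\<dots> = (\<Sum>l=1..n. (\<Sum>j=1..n. Y k j * A j l) * X i l)"
      by (simp add: sum_distrib_right)
    also have "\<dots> = (\<Sum>l=1..n. of_bool (k = l) * X i l)"
      using Y by (intro sum.cong) auto
    also have "\<dots> = X i k"
      using that by simp
    finally show ?thesis .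
  qed
  have "(\<Sum>i=1..n. X i k * A i k') = of_bool (k = k')" if "k \<in> {1..n}" "k' \<in> {1..n}" for k k'
    using Y[OF that(2), of k] YX[OF that(1)] by simp
  with X show ?thesis
    by (intro exI[of _ "\<lambda>k i. X i k"]) auto
qed

section \<open>Graded monomial orderings\<close>

lemma finite_multi_indices: "finite (multi_indices p :: 'd::finite multi_index set)"
proof (rule finite_subset)
  show "multi_indices p \<subseteq> vec_lambda ` (PiE UNIV (\<lambda>_ :: 'd. {..p}))"
  proof
    fix q :: "'d multi_index" assume "q \<in> multi_indices p"
    then have "q $ i \<le> p" for i
      using member_le_sum[of i UNIV "($) q"] by (simp add: multi_indices_def mdeg_def)
    then show "q \<in> vec_lambda ` (PiE UNIV (\<lambda>_ :: 'd. {..p}))"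
      by (intro image_eqI[of _ _ "vec_nth q"]) auto
  qed
qed (simp add: finite_PiE)

locale graded_ordering =
  fixes \<nu> :: "nat \<Rightarrow> 'd::finite multi_index"
  assumes graded: "graded_monomial_ordering \<nu>"
begin

lemma bij: "bij_betw \<nu> {1..} UNIV"
  and mdeg_less_imp_less: "1 \<le> i \<Longrightarrow> 1 \<le> j \<Longrightarrow> mdeg (\<nu> i) < mdeg (\<nu> j) \<Longrightarrow> i < j"
  using graded by (auto simp: graded_monomial_ordering_def)

lemma position_ge_1: "1 \<le> position \<nu> m"
proof -
  have "m \<in> \<nu> ` {1..}"
    unfolding bij_betw_imp_surj_on[OF bij] by simp
  from inv_into_into[OF this] show ?thesis
    by (simp add: position_def)
qed

lemma nu_position [simp]: "\<nu> (position \<nu> m) = m"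
  using bij by (simp add: position_def bij_betw_inv_into_right)

lemma position_nu [simp]: "1 \<le> i \<Longrightarrow> position \<nu> (\<nu> i) = i"
  using bij by (simp add: position_def bij_betw_inv_into_left)

lemma position_add_strict_mono:
  assumes "position \<nu> m < position \<nu> m'"
  shows "position \<nu> (m + k) < position \<nu> (m' + k)"
proof -
  have "\<forall>i\<ge>1. \<forall>j\<ge>1. \<forall>l\<ge>1. i < j \<longrightarrow> position \<nu> (\<nu> i + \<nu> l) < position \<nu> (\<nu> j + \<nu> l)"
    using graded by (simp add: graded_monomial_ordering_def)
  from this[rule_format, OF position_ge_1 position_ge_1 position_ge_1 assms, of k] show ?thesis
    by simp
qed

text \<open>Because the ordering is graded, the positions of the multi-indices of degree at most \<open>p\<close> are
  closed downwards, hence form an initial segment, whose length is found by counting. This allows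
  sums over matrix indices to be read as sums over multi-indices.\<close>

lemma nu_image: "\<nu> ` {1..multi_count TYPE('d) p} = multi_indices p"
proof -
  define A where "A = {i. 1 \<le> i \<and> \<nu> i \<in> multi_indices p}"
  have img: "\<nu> ` A = multi_indices p"
  proof
    show "multi_indices p \<subseteq> \<nu> ` A"
      using position_ge_1 by (auto simp: A_def intro!: rev_image_eqI[of "position \<nu> _"])
  qed (auto simp: A_def)
  have inj: "inj_on \<nu> A"
    by (rule inj_on_subset[OF bij_betw_imp_inj_on[OF bij]]) (auto simp: A_def)
  have fin: "finite A"
    using finite_image_iff[OF inj] img finite_multi_indices[where 'd = 'd] by metis
  have down: "i \<in> A" if "j \<in> A" "1 \<le> i" "i \<le> j" for i j
  proof -
    have "mdeg (\<nu> i) \<le> mdeg (\<nu> j)"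
      using that mdeg_less_imp_less[of j i] by (fastforce simp: not_less[symmetric])
    then show ?thesis
      using that by (auto simp: A_def multi_indices_def)
  qed
  have "card A = multi_count TYPE('d) p"
    using card_image[OF inj] img by (simp add: multi_count_def)
  moreover have "A = {1..card A}"
  proof (cases "A = {}")
    case False
    then have "A = {1..Max A}"
      using fin by (auto simp: A_def[THEN eqset_imp_iff] intro: down[OF Max_in])
    then show ?thesis
      by (metis card_atLeastAtMost diff_Suc_1)
  qed simp
  ultimately show ?thesis
    using img by simp
qed

lemma bij_betw_multi_indices: "bij_betw \<nu> {1..multi_count TYPE('d) p} (multi_indices p)"
  by (rule bij_betw_subset[OF bij _ nu_image]) auto

lemma position_le_multi_count_iff: "position \<nu> m \<le> multi_count TYPE('d) p \<longleftrightarrow> m \<in> multi_indices p"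
proof
  assume "position \<nu> m \<le> multi_count TYPE('d) p"
  then have "\<nu> (position \<nu> m) \<in> \<nu> ` {1..multi_count TYPE('d) p}"
    using position_ge_1 by (intro imageI) auto
  then show "m \<in> multi_indices p"
    by (simp only: nu_position nu_image)
next
  assume "m \<in> multi_indices p"
  then obtain i where "i \<in> {1..multi_count TYPE('d) p}" "m = \<nu> i"
    unfolding nu_image[symmetric] by blast
  then show "position \<nu> m \<le> multi_count TYPE('d) p" by simp
qed

lemma sum_nu: "(\<Sum>i = 1..multi_count TYPE('d) p. f (\<nu> i)) = sum f (multi_indices p)"
  by (rule sum.reindex_bij_betw[OF bij_betw_multi_indices])

end

section \<open>The compression of the derivatives of a solution\<close>

locale compression = graded_ordering \<nu> for \<nu> :: "nat \<Rightarrow> 'd::finite multi_index" +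
  fixes L :: "'d multi_index \<Rightarrow> complex" and c p :: nat
  assumes order: "has_order L c" and order_le: "c \<le> p"
begin

text \<open>The columns in \<open>J'\<close> are the pivots to be eliminated, those in \<open>J\<close> are retained.\<close>

abbreviation "P \<equiv> P_mat L c \<nu>"
abbreviation "M \<equiv> decomp_mat L c \<nu> p"
abbreviation "J \<equiv> j_set L c \<nu> p"
abbreviation "J' \<equiv> j_bar L c \<nu> p"
abbreviation "pivot \<equiv> last_col L c \<nu> p"

text \<open>The leading monomial of the symbol of the operator with respect to the ordering.\<close>

definition leading :: "'d multi_index" where
  "leading = \<nu> (Max (position \<nu> ` {m \<in> multi_indices c. L m \<noteq> 0}))"

lemma leading_in: "leading \<in> multi_indices c" "L leading \<noteq> 0"
  and leading_max: "m \<in> multi_indices c \<Longrightarrow> L m \<noteq> 0 \<Longrightarrow> position \<nu> m \<le> position \<nu> leading"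
proof -
  let ?A = "{m \<in> multi_indices c. L m \<noteq> 0}"
  have fin: "finite (position \<nu> ` ?A)"
    by (intro finite_imageI finite_subset[OF _ finite_multi_indices[of c]]) auto
  have "?A \<noteq> {}"
    using order by (auto simp: has_order_def multi_indices_def)
  then have "Max (position \<nu> ` ?A) \<in> position \<nu> ` ?A"
    using fin by (intro Max_in) auto
  then obtain m0 where m0: "m0 \<in> ?A" "Max (position \<nu> ` ?A) = position \<nu> m0"
    by blast
  then have "leading = m0"
    by (simp add: leading_def)
  then show "leading \<in> multi_indices c" "L leading \<noteq> 0"
    using m0 by auto
  show "position \<nu> m \<le> position \<nu> leading" if "m \<in> multi_indices c" "L m \<noteq> 0"
    using that Max_ge[OF fin, of "position \<nu> m"] m0(2) \<open>leading = m0\<close> by auto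
qed

lemma row_index_iff: "i \<in> {1..multi_count TYPE('d) (p - c)} \<longleftrightarrow> 1 \<le> i \<and> mdeg (\<nu> i) \<le> p - c"
proof (cases "1 \<le> i")
  case True
  then show ?thesis
    using position_le_multi_count_iff[of "\<nu> i" "p - c"] by (simp add: multi_indices_def)
qed simp

lemma multi_index_diff_add: "(m :: 'd multi_index) \<le> k \<Longrightarrow> m + (k - m) = k"
  by (simp add: vec_eq_iff less_eq_vec_def)

lemma P_nonzeroD:
  assumes "P i k \<noteq> 0"
  obtains m where "m \<in> multi_indices c" "L m \<noteq> 0" "\<nu> k = \<nu> i + m"
proof (rule that)
  have "\<nu> i \<le> \<nu> k \<and> \<nu> k - \<nu> i \<in> multi_indices c \<and> L (\<nu> k - \<nu> i) \<noteq> 0"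
    using assms by (simp add: P_mat_def b_coeff_def split: if_splits)
  then show "\<nu> k - \<nu> i \<in> multi_indices c" "L (\<nu> k - \<nu> i) \<noteq> 0" "\<nu> k = \<nu> i + (\<nu> k - \<nu> i)"
    using multi_index_diff_add[of "\<nu> i" "\<nu> k"] by auto
qed

lemma P_position_add: "m \<in> multi_indices c \<Longrightarrow> P i (position \<nu> (\<nu> i + m)) = L m"
  by (simp add: P_mat_def b_coeff_def less_eq_vec_def)

text \<open>Row \<open>i\<close> of \<open>P\<close> lists the coefficients of the operator multiplied by the monomial \<open>\<nu> i\<close>. As the
  ordering is compatible with multiplication, the leading monomial of the product is the product
  of the leading monomials.\<close>

lemma nonzero_column_le:
  assumes "P i k \<noteq> 0" "1 \<le> k"
  shows "k \<le> position \<nu> (\<nu> i + leading)"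
proof -
  obtain m where m: "m \<in> multi_indices c" "L m \<noteq> 0" "\<nu> k = \<nu> i + m"
    using P_nonzeroD[OF assms(1)] .
  have "k = position \<nu> (m + \<nu> i)"
    using m(3) assms(2) by (metis add.commute position_nu)
  also have "\<dots> \<le> position \<nu> (leading + \<nu> i)"
    using leading_max[OF m(1,2)] position_add_strict_mono[of m leading "\<nu> i"]
    by (metis nat_less_le nu_position order_refl)
  finally show ?thesis by (simp add: add.commute)
qed

lemma pivot_eq:
  assumes "i \<in> {1..multi_count TYPE('d) (p - c)}"
  shows "pivot i = position \<nu> (\<nu> i + leading)"
  unfolding last_col_def
proof (rule Max_eqI)
  have "mdeg (\<nu> i + leading) \<le> p"
    using assms leading_in(1) order_le unfolding row_index_iff
    by (auto simp: mdeg_add multi_indices_def)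
  then show "position \<nu> (\<nu> i + leading) \<in> {k \<in> {1..multi_count TYPE('d) p}. P i k \<noteq> 0}"
    using leading_in position_ge_1
    by (simp add: P_position_add position_le_multi_count_iff multi_indices_def)
  show "k \<le> position \<nu> (\<nu> i + leading)" if "k \<in> {k \<in> {1..multi_count TYPE('d) p}. P i k \<noteq> 0}" for k
    using that nonzero_column_le[of i k] by simp
qed simp

lemma pivot_in:
  assumes "i \<in> {1..multi_count TYPE('d) (p - c)}"
  shows "pivot i \<in> {1..multi_count TYPE('d) p}"
proof -
  have "mdeg (\<nu> i + leading) \<le> p"
    using assms leading_in(1) order_le unfolding row_index_iff
    by (auto simp: mdeg_add multi_indices_def)
  then show ?thesis
    using position_ge_1 by (simp add: pivot_eq[OF assms] position_le_multi_count_iff multi_indices_def)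
qed

lemma P_pivot: "i \<in> {1..multi_count TYPE('d) (p - c)} \<Longrightarrow> P i (pivot i) \<noteq> 0"
  using leading_in by (simp add: pivot_eq P_position_add)

lemma P_beyond_pivot: "i \<in> {1..multi_count TYPE('d) (p - c)} \<Longrightarrow> pivot i < k \<Longrightarrow> P i k = 0"
  using nonzero_column_le[of i k] by (cases "P i k = 0") (simp_all add: pivot_eq)

lemma pivot_strict_mono:
  assumes "i \<in> {1..multi_count TYPE('d) (p - c)}" "i' \<in> {1..multi_count TYPE('d) (p - c)}" "i < i'"
  shows "pivot i < pivot i'"
  using assms position_add_strict_mono[of "\<nu> i" "\<nu> i'" leading] by (simp add: pivot_eq)

lemma inj_pivot: "inj_on pivot {1..multi_count TYPE('d) (p - c)}"
  by (rule linorder_inj_onI) (metis pivot_strict_mono less_irrefl, auto)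

text \<open>Consequently the pivots increase strictly with the row, and \<open>P\<close> restricted to the
  pivot columns is lower triangular with the nonzero diagonal entry \<open>L leading\<close>. This is what makes
  the choice in the definition of \<^const>\<open>matrix_inv_on\<close> meaningful: an inverse exists.\<close>

abbreviation "B \<equiv> matrix_inv_on {1..multi_count TYPE('d) (p - c)} J' P"

lemma P_B: "i \<in> {1..multi_count TYPE('d) (p - c)} \<Longrightarrow> i' \<in> {1..multi_count TYPE('d) (p - c)} \<Longrightarrow>
      (\<Sum>j\<in>J'. P i j * B j i') = of_bool (i = i')"
  and B_P: "j \<in> J' \<Longrightarrow> j' \<in> J' \<Longrightarrow>
      (\<Sum>i = 1..multi_count TYPE('d) (p - c). B j i * P i j') = of_bool (j = j')"
proof -
  have "\<exists>X. (\<forall>i\<in>{1..multi_count TYPE('d) (p - c)}. \<forall>i'\<in>{1..multi_count TYPE('d) (p - c)}. (\<Sum>k = 1..multi_count TYPE('d) (p - c). P i (pivot k) * X k i') = of_bool (i = i')) \<and>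
            (\<forall>k\<in>{1..multi_count TYPE('d) (p - c)}. \<forall>k'\<in>{1..multi_count TYPE('d) (p - c)}. (\<Sum>i = 1..multi_count TYPE('d) (p - c). X k i * P i (pivot k')) = of_bool (k = k'))"
  proof (rule lower_triangular_inverse)
    show "P i (pivot k) = 0"
      if "i \<in> {1..multi_count TYPE('d) (p - c)}" "k \<in> {1..multi_count TYPE('d) (p - c)}" "i < k" for i k
      using that by (intro P_beyond_pivot pivot_strict_mono)
  qed (rule P_pivot)
  then obtain X where
    X: "\<And>i i'. i \<in> {1..multi_count TYPE('d) (p - c)} \<Longrightarrow> i' \<in> {1..multi_count TYPE('d) (p - c)} \<Longrightarrow> (\<Sum>k = 1..multi_count TYPE('d) (p - c). P i (pivot k) * X k i') = of_bool (i = i')"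
       "\<And>k k'. k \<in> {1..multi_count TYPE('d) (p - c)} \<Longrightarrow> k' \<in> {1..multi_count TYPE('d) (p - c)} \<Longrightarrow> (\<Sum>i = 1..multi_count TYPE('d) (p - c). X k i * P i (pivot k')) = of_bool (k = k')"
    by blast
  let ?X = "\<lambda>j i. X (inv_into {1..multi_count TYPE('d) (p - c)} pivot j) i"
  have inv: "inv_into {1..multi_count TYPE('d) (p - c)} pivot (pivot k) = k" if "k \<in> {1..multi_count TYPE('d) (p - c)}" for k
    using inj_pivot that by (rule inv_into_f_f)
  have "\<exists>B. (\<forall>i\<in>{1..multi_count TYPE('d) (p - c)}. \<forall>i'\<in>{1..multi_count TYPE('d) (p - c)}. (\<Sum>j\<in>J'. P i j * B j i') = of_bool (i = i')) \<and>
     (\<forall>j\<in>J'. \<forall>j'\<in>J'. (\<Sum>i\<in>{1..multi_count TYPE('d) (p - c)}. B j i * P i j') = of_bool (j = j'))"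
  proof (intro exI[of _ ?X] conjI ballI)
    show "(\<Sum>j\<in>J'. P i j * ?X j i') = of_bool (i = i')" if "i \<in> {1..multi_count TYPE('d) (p - c)}" "i' \<in> {1..multi_count TYPE('d) (p - c)}" for i i'
    proof -
      have "(\<Sum>j\<in>J'. P i j * ?X j i') = (\<Sum>k = 1..multi_count TYPE('d) (p - c). P i (pivot k) * X k i')"
        unfolding j_bar_def sum.reindex[OF inj_pivot] o_def
        by (intro sum.cong refl) (simp only: inv)
      with X(1)[OF that] show ?thesis by simp
    qed
    show "(\<Sum>i\<in>{1..multi_count TYPE('d) (p - c)}. ?X j i * P i j') = of_bool (j = j')" if jj: "j \<in> J'" "j' \<in> J'" for j j'
    proof -
      obtain k k' where k: "k \<in> {1..multi_count TYPE('d) (p - c)}" "j = pivot k" "k' \<in> {1..multi_count TYPE('d) (p - c)}" "j' = pivot k'"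
        using jj unfolding j_bar_def by blast
      then have "(j = j') = (k = k')"
        using inj_pivot by (auto dest: inj_onD)
      with X(2)[OF k(1,3)] k show ?thesis
        by (simp only: inv)
    qed
  qed
  then have "(\<forall>i\<in>{1..multi_count TYPE('d) (p - c)}. \<forall>i'\<in>{1..multi_count TYPE('d) (p - c)}. (\<Sum>j\<in>J'. P i j * B j i') = of_bool (i = i')) \<and>
     (\<forall>j\<in>J'. \<forall>j'\<in>J'. (\<Sum>i\<in>{1..multi_count TYPE('d) (p - c)}. B j i * P i j') = of_bool (j = j'))"
    unfolding matrix_inv_on_def by (rule someI_ex)
  then show
    "i \<in> {1..multi_count TYPE('d) (p - c)} \<Longrightarrow> i' \<in> {1..multi_count TYPE('d) (p - c)} \<Longrightarrow>
      (\<Sum>j\<in>J'. P i j * B j i') = of_bool (i = i')"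
    "j \<in> J' \<Longrightarrow> j' \<in> J' \<Longrightarrow>
      (\<Sum>i = 1..multi_count TYPE('d) (p - c). B j i * P i j') = of_bool (j = j')"
    by blast+
qed

lemma M_J': "i \<in> J' \<Longrightarrow> M i s = - (\<Sum>r = 1..multi_count TYPE('d) (p - c). B i r * P r s)"
  by (simp add: decomp_mat_def j_set_def)

lemma J'_subset: "J' \<subseteq> {1..multi_count TYPE('d) p}"
  using pivot_in by (auto simp: j_bar_def)

lemma finite_J: "finite J" "finite J'"
  by (simp_all add: j_set_def j_bar_def)

lemma M_J: "i \<in> J \<Longrightarrow> M i s = of_bool (i = s)"
  by (simp add: decomp_mat_def)

lemma sum_J_J': "(\<Sum>i = 1..multi_count TYPE('d) p. f i) = sum f J + sum f J'"
  using sum.subset_diff[OF J'_subset, of f] by (simp add: j_set_def)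

text \<open>On the pivot columns \<open>P\<close> is cancelled by its inverse \<open>B\<close>, leaving \<open>- P r s\<close>; on the others \<open>M\<close> is
  the identity, which contributes \<open>P r s\<close>.\<close>

lemma P_M:
  assumes "r \<in> {1..multi_count TYPE('d) (p - c)}" "s \<in> J"
  shows "(\<Sum>i = 1..multi_count TYPE('d) p. P r i * M i s) = 0"
proof -
  have "(\<Sum>i\<in>J'. P r i * M i s) = - (\<Sum>i\<in>J'. \<Sum>q = 1..multi_count TYPE('d) (p - c). P r i * B i q * P q s)"
    by (simp add: M_J' sum_negf sum_distrib_left mult.assoc)
  also have "\<dots> = - (\<Sum>q = 1..multi_count TYPE('d) (p - c). (\<Sum>i\<in>J'. P r i * B i q) * P q s)"
    by (subst sum.swap) (simp add: sum_distrib_right)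
  also have "(\<Sum>q = 1..multi_count TYPE('d) (p - c). (\<Sum>i\<in>J'. P r i * B i q) * P q s) = (\<Sum>q = 1..multi_count TYPE('d) (p - c). of_bool (r = q) * P q s)"
    using P_B[OF assms(1)] by (intro sum.cong) auto
  also have "\<dots> = P r s"
    using assms(1) by simp
  finally have "(\<Sum>i\<in>J'. P r i * M i s) = - P r s" .
  moreover have "(\<Sum>i\<in>J. P r i * M i s) = P r s"
    using assms(2) finite_J by (simp add: M_J)
  ultimately show ?thesis
    unfolding sum_J_J' by simp
qed

text \<open>Induction on the row \<open>i\<close>. If \<open>i\<close> is the pivot of row \<open>r\<close> of \<open>P\<close>, then in row \<open>r\<close> of
  \<open>P M = 0\<close> the terms to the left of the pivot vanish by induction and those to the right because
  \<open>P\<close> vanishes there.\<close>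

lemma M_lower_triangular:
  assumes "s \<in> J" "i \<in> {1..multi_count TYPE('d) p}" "i < s"
  shows "M i s = 0"
  using assms(2,3)
proof (induction i rule: less_induct)
  case (less i)
  show ?case
  proof (cases "i \<in> J")
    case True
    then show ?thesis using less.prems by (simp add: M_J)
  next
    case False
    then obtain r where r: "r \<in> {1..multi_count TYPE('d) (p - c)}" "i = pivot r"
      using less.prems by (auto simp: j_set_def j_bar_def)
    have "(\<Sum>k = 1..multi_count TYPE('d) p. P r k * M k s) = (\<Sum>k\<in>{i}. P r k * M k s)"
    proof (rule sum.mono_neutral_right)
      show "\<forall>k\<in>{1..multi_count TYPE('d) p} - {i}. P r k * M k s = 0"
      proof
        fix k assume k: "k \<in> {1..multi_count TYPE('d) p} - {i}"
        show "P r k * M k s = 0"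
        proof (cases "k < i")
          case True
          with k less show ?thesis by simp
        next
          case False
          with k r show ?thesis by (simp add: P_beyond_pivot)
        qed
      qed
    qed (use less.prems in auto)
    then have "P r i * M i s = 0"
      using P_M[OF r(1) assms(1)] by simp
    then show ?thesis
      using P_pivot[OF r(1)] r(2) by simp
  qed
qed

text \<open>Conversely, a vector in the kernel of \<open>P\<close> is determined by its entries outside the pivot
  columns: multiply \<open>P g = 0\<close> by the inverse of the pivot part.\<close>

lemma decompress:
  assumes g: "\<And>r. r \<in> {1..multi_count TYPE('d) (p - c)} \<Longrightarrow> (\<Sum>i = 1..multi_count TYPE('d) p. P r i * g i) = 0" and i: "i \<in> {1..multi_count TYPE('d) p}"
  shows "g i = (\<Sum>s\<in>J. M i s * g s)"
proof (cases "i \<in> J")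
  case True
  then show ?thesis using finite_J by (simp add: M_J)
next
  case False
  then have i: "i \<in> J'"
    using i by (simp add: j_set_def)
  have PJ: "(\<Sum>s\<in>J. P r s * g s) = - (\<Sum>k\<in>J'. P r k * g k)" if "r \<in> {1..multi_count TYPE('d) (p - c)}" for r
    using g[OF that] unfolding sum_J_J' by (simp add: add_eq_0_iff2)
  have "(\<Sum>s\<in>J. M i s * g s) = - (\<Sum>s\<in>J. \<Sum>r = 1..multi_count TYPE('d) (p - c). B i r * (P r s * g s))"
    by (simp add: M_J'[OF i] sum_negf sum_distrib_right mult.assoc)
  also have "\<dots> = - (\<Sum>r = 1..multi_count TYPE('d) (p - c). B i r * (\<Sum>s\<in>J. P r s * g s))"
    by (subst sum.swap) (simp add: sum_distrib_left)
  also have "\<dots> = (\<Sum>r = 1..multi_count TYPE('d) (p - c). B i r * (\<Sum>k\<in>J'. P r k * g k))"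
    by (simp add: PJ sum_negf)
  also have "\<dots> = (\<Sum>k\<in>J'. (\<Sum>r = 1..multi_count TYPE('d) (p - c). B i r * P r k) * g k)"
    unfolding sum_distrib_left sum_distrib_right by (subst sum.swap) (simp add: mult.assoc)
  also have "\<dots> = (\<Sum>k\<in>J'. of_bool (i = k) * g k)"
    using B_P[OF i] by (intro sum.cong) auto
  also have "\<dots> = g i"
    using i finite_J by simp
  finally show ?thesis by simp
qed

abbreviation "v \<equiv> v_coeff L c \<nu> p"
abbreviation "S \<equiv> \<nu> ` J"

lemma J_subset: "J \<subseteq> {1..multi_count TYPE('d) p}"
  by (auto simp: j_set_def)

lemma sum_S: "sum f S = (\<Sum>s\<in>J. f (\<nu> s))"
proof -
  have "inj_on \<nu> J"
    by (rule inj_on_subset[OF bij_betw_imp_inj_on[OF bij]]) (use J_subset in auto)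
  then show ?thesis
    by (simp add: sum.reindex)
qed

lemma position_in_J:
  assumes "s \<in> S"
  shows "position \<nu> s \<in> J"
proof -
  obtain i where "i \<in> J" "s = \<nu> i" using assms by blast
  moreover have "1 \<le> i" using \<open>i \<in> J\<close> J_subset by auto
  ultimately show ?thesis by simp
qed

text \<open>Triangularity in terms of degrees, since a multi-index of larger degree comes later.\<close>

lemma v_eq_0:
  assumes "k \<in> multi_indices p" "s \<in> S" "mdeg k < mdeg s"
  shows "v k s = 0"
  unfolding v_coeff_def
proof (rule M_lower_triangular)
  show "position \<nu> k < position \<nu> s"
    by (rule mdeg_less_imp_less[OF position_ge_1 position_ge_1]) (simp add: assms(3))
  show "position \<nu> s \<in> J" by (rule position_in_J[OF assms(2)])
  show "position \<nu> k \<in> {1..multi_count TYPE('d) p}"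
    using assms(1) position_ge_1 by (simp add: position_le_multi_count_iff)
qed

lemma P_row_sum:
  assumes "r \<in> {1..multi_count TYPE('d) (p - c)}"
  shows "(\<Sum>i = 1..multi_count TYPE('d) p. P r i * f (\<nu> i)) = (\<Sum>m\<in>multi_indices c. L m * f (\<nu> r + m))"
proof -
  have "(\<Sum>i = 1..multi_count TYPE('d) p. P r i * f (\<nu> i)) = (\<Sum>k\<in>multi_indices p. b_coeff L c (\<nu> r) k * f k)"
    unfolding P_mat_def by (rule sum_nu)
  also have "\<dots> = (\<Sum>k\<in>(+) (\<nu> r) ` multi_indices c. b_coeff L c (\<nu> r) k * f k)"
  proof (rule sum.mono_neutral_right)
    show "(+) (\<nu> r) ` multi_indices c \<subseteq> multi_indices p"
      using assms order_le unfolding row_index_iff by (auto simp: multi_indices_def mdeg_add)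
    show "\<forall>k\<in>multi_indices p - (+) (\<nu> r) ` multi_indices c. b_coeff L c (\<nu> r) k * f k = 0"
      using multi_index_diff_add[of "\<nu> r"] by (force simp: b_coeff_def)
  qed (rule finite_multi_indices)
  also have "\<dots> = (\<Sum>m\<in>multi_indices c. L m * f (\<nu> r + m))"
    by (subst sum.reindex) (auto simp: b_coeff_def less_eq_vec_def intro!: sum.cong)
  finally show ?thesis .
qed

text \<open>Row \<open>r\<close> of \<open>P\<close>, applied to the derivatives \<open>\<partial>\<^bsup>\<nu> i + l\<^esup> G\<close>, yields \<open>\<partial>\<^bsup>\<nu> r + l\<^esup>(\<L>G) = 0\<close>, so
  these derivatives form a vector in the kernel of \<open>P\<close>. The highest order that occurs is
  \<open>(p - c) + p + c = 2 p\<close>, the smoothness available.\<close>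

lemma multi_deriv_decompress:
  assumes C: "Ck_on (2 * p) G U" "open U" "x \<in> U"
    and eq: "\<And>y. y \<in> U \<Longrightarrow> diff_op L c G y = 0"
    and k: "k \<in> multi_indices p" and l: "l \<in> multi_indices p"
  shows "multi_deriv (k + l) G x = (\<Sum>s\<in>S. v k s * multi_deriv (s + l) G x)"
proof -
  have "multi_deriv (\<nu> (position \<nu> k) + l) G x =
    (\<Sum>s\<in>J. M (position \<nu> k) s * multi_deriv (\<nu> s + l) G x)"
  proof (rule decompress)
    show "position \<nu> k \<in> {1..multi_count TYPE('d) p}"
      using k position_ge_1 by (simp add: position_le_multi_count_iff)
    show "(\<Sum>i = 1..multi_count TYPE('d) p. P r i * multi_deriv (\<nu> i + l) G x) = 0" if r: "r \<in> {1..multi_count TYPE('d) (p - c)}" for r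
    proof -
      have "(\<Sum>i = 1..multi_count TYPE('d) p. P r i * multi_deriv (\<nu> i + l) G x) =
            (\<Sum>m\<in>multi_indices c. L m * multi_deriv ((\<nu> r + l) + m) G x)"
        using P_row_sum[OF r, of "\<lambda>q. multi_deriv (q + l) G x"] by (simp add: add_ac)
      also have "mdeg (\<nu> r + l) + c \<le> 2 * p"
        using r l order_le unfolding row_index_iff by (auto simp: mdeg_add multi_indices_def)
      then have "(\<Sum>m\<in>multi_indices c. L m * multi_deriv ((\<nu> r + l) + m) G x) = 0"
        by (intro diff_op_differentiated[OF C] eq)
      finally show ?thesis .
    qed
  qed
  also have "\<dots> = (\<Sum>s\<in>S. v k s * multi_deriv (s + l) G x)"
    unfolding sum_S
  proof (rule sum.cong)
    fix s assume "s \<in> J"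
    then have "1 \<le> s" using J_subset by auto
    then show "M (position \<nu> k) s * multi_deriv (\<nu> s + l) G x =
        v k (\<nu> s) * multi_deriv (\<nu> s + l) G x"
      by (simp add: v_coeff_def)
  qed simp
  finally show ?thesis by simp
qed

end

section \<open>Translation and truncated Taylor expansions\<close>

definition taylor_weight :: "real ^ 'd \<Rightarrow> 'd::finite multi_index \<Rightarrow> complex" where
  "taylor_weight h l = of_real (mpow h l / real (mfact l))"

text \<open>With \<open>D q\<close> standing for \<open>\<partial>\<^sup>q G(z)\<close>, this is the Taylor expansion of \<open>\<partial>\<^sup>q G(z + h)\<close> in which
  only derivatives of \<open>G\<close> up to the total order \<open>p\<close> are kept. The truncation is written as a factor
  in order that the range of summation does not depend on \<open>q\<close>.\<close>

definition truncated_taylor ::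
    "nat \<Rightarrow> real ^ 'd \<Rightarrow> ('d::finite multi_index \<Rightarrow> complex) \<Rightarrow> 'd multi_index \<Rightarrow> complex" where
  "truncated_taylor p h D q =
     (\<Sum>l\<in>multi_indices p. of_bool (mdeg q + mdeg l \<le> p) * (taylor_weight h l * D (q + l)))"

lemma norm_taylor_weight_le:
  assumes "norm h \<le> R"
  shows "cmod (taylor_weight h l) \<le> R ^ mdeg l"
proof -
  have "\<bar>mpow h l\<bar> \<le> (\<Prod>i\<in>UNIV. norm h ^ (l $ i))"
    unfolding mpow_def abs_prod power_abs
    by (intro prod_mono conjI power_mono component_le_norm_cart) auto
  also have "\<dots> = norm h ^ mdeg l"
    by (simp add: mdeg_def power_sum)
  also have "\<dots> \<le> R ^ mdeg l"
    using assms by (intro power_mono) auto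
  finally have *: "\<bar>mpow h l\<bar> \<le> R ^ mdeg l" .
  have "0 < mfact l"
    unfolding mfact_def by (rule prod_pos) simp
  then have "real (mfact l) \<ge> 1"
    by simp
  then have "\<bar>mpow h l\<bar> / real (mfact l) \<le> \<bar>mpow h l\<bar>"
    using divide_left_mono[of 1 "real (mfact l)" "\<bar>mpow h l\<bar>"] by simp
  with * show ?thesis
    by (simp add: taylor_weight_def norm_divide norm_of_real)
qed

context graded_ordering
begin

text \<open>Collect the terms by the source index \<open>i\<close> instead of the target index \<open>n\<close> and substitute
  \<open>l = \<nu> n - \<nu> i\<close>.\<close>

lemma sum_translate:
  "(\<Sum>n = 1..multi_count TYPE('d) p. translate \<nu> p h w n * D (\<nu> n)) =
   (\<Sum>i = 1..multi_count TYPE('d) p. w i * truncated_taylor p h D (\<nu> i))"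
proof -
  let ?I = "{1..multi_count TYPE('d) p}"
  have "(\<Sum>n\<in>?I. translate \<nu> p h w n * D (\<nu> n)) =
        (\<Sum>n\<in>?I. \<Sum>i | i \<in> ?I \<and> \<nu> i \<le> \<nu> n. taylor_weight h (\<nu> n - \<nu> i) * w i * D (\<nu> n))"
    by (simp add: translate_def taylor_weight_def sum_distrib_right)
  also have "\<dots> = (\<Sum>i\<in>?I. \<Sum>n | n \<in> ?I \<and> \<nu> i \<le> \<nu> n. taylor_weight h (\<nu> n - \<nu> i) * w i * D (\<nu> n))"
    by (rule sum.swap_restrict) auto
  also have "\<dots> = (\<Sum>i\<in>?I. w i * truncated_taylor p h D (\<nu> i))"
  proof (rule sum.cong)
    fix i assume i: "i \<in> ?I"
    have "(\<Sum>n | n \<in> ?I \<and> \<nu> i \<le> \<nu> n. taylor_weight h (\<nu> n - \<nu> i) * w i * D (\<nu> n)) =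
          (\<Sum>l | l \<in> multi_indices p \<and> mdeg (\<nu> i) + mdeg l \<le> p. taylor_weight h l * w i * D (\<nu> i + l))"
    proof (rule sum.reindex_bij_witness[of _ "\<lambda>l. position \<nu> (\<nu> i + l)" "\<lambda>n. \<nu> n - \<nu> i"])
      fix n assume n: "n \<in> {n. n \<in> ?I \<and> \<nu> i \<le> \<nu> n}"
      then have split: "\<nu> i + (\<nu> n - \<nu> i) = \<nu> n"
        by (simp add: vec_eq_iff less_eq_vec_def)
      have "\<nu> n \<in> multi_indices p"
        using n nu_image by blast
      then have "mdeg (\<nu> i) + mdeg (\<nu> n - \<nu> i) \<le> p"
        unfolding mdeg_add[symmetric] split by (simp add: multi_indices_def)
      then show "\<nu> n - \<nu> i \<in> {l. l \<in> multi_indices p \<and> mdeg (\<nu> i) + mdeg l \<le> p}"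
        by (simp add: multi_indices_def)
      show "position \<nu> (\<nu> i + (\<nu> n - \<nu> i)) = n"
        using n by (simp add: split)
      show "taylor_weight h (\<nu> n - \<nu> i) * w i * D (\<nu> i + (\<nu> n - \<nu> i)) =
            taylor_weight h (\<nu> n - \<nu> i) * w i * D (\<nu> n)"
        by (simp add: split)
    next
      fix l :: "'d multi_index" assume l: "l \<in> {l. l \<in> multi_indices p \<and> mdeg (\<nu> i) + mdeg l \<le> p}"
      show "\<nu> (position \<nu> (\<nu> i + l)) - \<nu> i = l"
        by (simp add: vec_eq_iff)
      have "\<nu> i + l \<in> multi_indices p"
        using l by (simp add: multi_indices_def mdeg_add)
      then show "position \<nu> (\<nu> i + l) \<in> {n. n \<in> ?I \<and> \<nu> i \<le> \<nu> n}"
        using position_ge_1 by (simp add: position_le_multi_count_iff less_eq_vec_def)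
    qed
    also have "\<dots> = w i * truncated_taylor p h D (\<nu> i)"
      unfolding truncated_taylor_def sum_distrib_left sum.inter_filter[OF finite_multi_indices]
      by (intro sum.cong) auto
    finally show "(\<Sum>n | n \<in> ?I \<and> \<nu> i \<le> \<nu> n. taylor_weight h (\<nu> n - \<nu> i) * w i * D (\<nu> n)) =
      w i * truncated_taylor p h D (\<nu> i)" .
  qed simp
  finally show ?thesis .
qed

end

section \<open>Size of the compression error\<close>

text \<open>Each order beyond \<open>p + 1\<close> contributes a factor \<open>R / r < 1\<close>, and the remaining factor \<open>1 / r\<close>
  is at most \<open>1 / (r - R)\<close>.\<close>

lemma geometric_decay_bound:
  fixes R r K e :: real
  assumes "0 < R" "R < r" "0 \<le> K" "p < n"
  shows "R ^ n * (K / r powr (real n + e)) \<le> K * (R ^ (p + 1) / (r powr (real p + e) * (r - R)))"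
proof -
  obtain m where n: "n = p + 1 + m"
    using assms(4) by (metis Suc_eq_plus1 less_iff_Suc_add add_Suc add.commute)
  have r: "0 < r" using assms by linarith
  have "r powr (real n + e) = r powr (real p + e) * r * r ^ m"
    using r by (simp add: n powr_add powr_realpow[symmetric] mult_ac)
  then have "R ^ n * (K / r powr (real n + e)) =
      K * (R ^ (p + 1) / (r powr (real p + e) * r) * (R / r) ^ m)"
    by (simp add: n power_add power_divide)
  also have "\<dots> \<le> K * (R ^ (p + 1) / (r powr (real p + e) * r) * 1)"
    using assms r by (intro mult_left_mono power_le_one) auto
  also have "\<dots> \<le> K * (R ^ (p + 1) / (r powr (real p + e) * (r - R)))"
    using assms r by (auto intro!: mult_left_mono divide_left_mono mult_pos_pos)
  finally show ?thesis .
qed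

context compression
begin

text \<open>The relation splits \<open>D (k + l)\<close> into terms with \<open>|s| + |l| \<le> p\<close>, which are those present in the
  truncated expansions, and terms of higher order. If \<open>|k| + |l| \<le> p\<close>, the second part is empty
  because of \<open>v_eq_0\<close>, and the contributions for this \<open>l\<close> cancel. Otherwise the first part is
  expressed by \<open>D (k + l)\<close> and the second part. Either way only derivatives of order above \<open>p\<close>
  remain.\<close>

lemma taylor_defect:
  assumes rel: "\<And>l. l \<in> multi_indices p \<Longrightarrow> D (k + l) = (\<Sum>s\<in>S. v k s * D (s + l))"
    and k: "k \<in> multi_indices p"
  shows "(\<Sum>s\<in>S. v k s * truncated_taylor p h D s) - truncated_taylor p h D k =
    (\<Sum>l\<in>multi_indices p. of_bool (p < mdeg k + mdeg l) *
       (taylor_weight h l * (D (k + l) - (\<Sum>s\<in>S. of_bool (p < mdeg s + mdeg l) * (v k s * D (s + l))))))"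
    (is "?lhs = ?rhs")
proof -
  have "?lhs = (\<Sum>l\<in>multi_indices p. taylor_weight h l *
      ((\<Sum>s\<in>S. of_bool (mdeg s + mdeg l \<le> p) * (v k s * D (s + l)))
        - of_bool (mdeg k + mdeg l \<le> p) * D (k + l)))"
  proof -
    have "(\<Sum>s\<in>S. v k s * truncated_taylor p h D s) =
       (\<Sum>s\<in>S. \<Sum>l\<in>multi_indices p. taylor_weight h l * (of_bool (mdeg s + mdeg l \<le> p) * (v k s * D (s + l))))"
      unfolding truncated_taylor_def sum_distrib_left by (simp add: mult_ac)
    also have "\<dots> = (\<Sum>l\<in>multi_indices p. \<Sum>s\<in>S. taylor_weight h l * (of_bool (mdeg s + mdeg l \<le> p) * (v k s * D (s + l))))"
      by (rule sum.swap)
    finally show ?thesis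
      unfolding truncated_taylor_def right_diff_distrib sum_subtractf sum_distrib_left
      by (simp add: mult_ac)
  qed
  also have "\<dots> = ?rhs"
  proof (rule sum.cong)
    fix l :: "'d multi_index" assume l: "l \<in> multi_indices p"
    let ?low = "\<Sum>s\<in>S. of_bool (mdeg s + mdeg l \<le> p) * (v k s * D (s + l))"
    let ?high = "\<Sum>s\<in>S. of_bool (p < mdeg s + mdeg l) * (v k s * D (s + l))"
    have "D (k + l) = ?low + ?high"
      unfolding rel[OF l] sum.distrib[symmetric] by (intro sum.cong) auto
    moreover have "?high = 0" if "mdeg k + mdeg l \<le> p"
    proof (rule sum.neutral, rule ballI)
      fix s assume "s \<in> S"
      then show "of_bool (p < mdeg s + mdeg l) * (v k s * D (s + l)) = 0"
        using v_eq_0[OF k, of s] that by (cases "mdeg k < mdeg s") auto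
    qed
    ultimately show "taylor_weight h l * (?low - of_bool (mdeg k + mdeg l \<le> p) * D (k + l)) =
      of_bool (p < mdeg k + mdeg l) * (taylor_weight h l * (D (k + l) - ?high))"
      by (cases "mdeg k + mdeg l \<le> p") auto
  qed simp
  finally show ?thesis .
qed

text \<open>Since \<open>\<beta> = M\<^sup>T \<alpha>\<close>, pairing \<open>\<beta>\<close> with \<open>T\<close> on the retained indices is pairing \<open>\<alpha>\<close> with \<open>M T\<close>.\<close>

lemma sum_embed_compress:
  "(\<Sum>i = 1..multi_count TYPE('d) p.
      embed_coeffs L c \<nu> p (compress L c \<nu> p \<alpha>) i * T (\<nu> i)) =
   (\<Sum>i = 1..multi_count TYPE('d) p. \<alpha> i * (\<Sum>s\<in>S. v (\<nu> i) s * T s))"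
proof -
  let ?I = "{1..multi_count TYPE('d) p}"
  have "(\<Sum>i\<in>?I. embed_coeffs L c \<nu> p (compress L c \<nu> p \<alpha>) i * T (\<nu> i)) =
        (\<Sum>s\<in>J. compress L c \<nu> p \<alpha> s * T (\<nu> s))"
    by (rule sum.mono_neutral_cong_right) (use J_subset in \<open>auto simp: embed_coeffs_def\<close>)
  also have "\<dots> = (\<Sum>s\<in>J. \<Sum>i\<in>?I. \<alpha> i * (M i s * T (\<nu> s)))"
    unfolding compress_def sum_distrib_right by (simp add: mult_ac)
  also have "\<dots> = (\<Sum>i\<in>?I. \<Sum>s\<in>J. \<alpha> i * (M i s * T (\<nu> s)))"
    by (rule sum.swap)
  also have "\<dots> = (\<Sum>i\<in>?I. \<alpha> i * (\<Sum>s\<in>S. v (\<nu> i) s * T s))"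
    unfolding sum_S sum_distrib_left
  proof (intro sum.cong refl)
    fix i s assume "i \<in> ?I" "s \<in> J"
    then have "1 \<le> i" "1 \<le> s" using J_subset by auto
    then show "\<alpha> i * (M i s * T (\<nu> s)) = \<alpha> i * (v (\<nu> i) (\<nu> s) * T (\<nu> s))"
      by (simp add: v_coeff_def)
  qed
  finally show ?thesis .
qed

text \<open>\<open>Q\<close> is the decay bound for order \<open>|k| + |l|\<close>. A derivative of the possibly lower order
  \<open>|s| + |l|\<close> is bounded by \<open>r\<^bsup>|k| - |s|\<^esup> Q\<close>, and the bound on \<open>v k s\<close> compensates for this
  factor, because \<open>r \<le> a\<close> and \<open>|s| \<le> |k|\<close>.\<close>

lemma defect_term_bound:
  fixes M\<^sub>0 M\<^sub>1 :: real
  assumes "0 < R" "R < r" "r \<le> a" "0 \<le> M\<^sub>0" "0 \<le> M\<^sub>1"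
    and A: "cmod A \<le> R ^ mdeg k" and H: "cmod H \<le> R ^ mdeg l"
    and decay: "\<And>q. p < mdeg q \<Longrightarrow> cmod (D q) \<le> M\<^sub>0 / r powr (real (mdeg q) + e)"
    and v: "\<And>s. s \<in> S \<Longrightarrow> mdeg s \<le> mdeg k \<Longrightarrow> cmod (v k s) \<le> M\<^sub>1 / a ^ (mdeg k - mdeg s)"
    and k: "k \<in> multi_indices p" and kl: "p < mdeg k + mdeg l"
  shows "cmod (A * (H * (D (k + l) - (\<Sum>s\<in>S. of_bool (p < mdeg s + mdeg l) * (v k s * D (s + l))))))
    \<le> (1 + card S * M\<^sub>1) * M\<^sub>0 * (R ^ (p + 1) / (r powr (real p + e) * (r - R)))"
proof -
  let ?n = "mdeg k + mdeg l"
  define Q where "Q = M\<^sub>0 / r powr (real ?n + e)"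
  have r: "0 < r" using assms by linarith
  have Q: "0 \<le> Q" using assms r by (simp add: Q_def)
  have k_bound: "cmod (D (k + l)) \<le> Q"
    using decay[of "k + l"] kl by (simp add: mdeg_add Q_def)
  have s_bound: "cmod (of_bool (p < mdeg s + mdeg l) * (v k s * D (s + l))) \<le> M\<^sub>1 * Q"
    if s: "s \<in> S" for s
  proof (cases "p < mdeg s + mdeg l \<and> mdeg s \<le> mdeg k")
    case True
    then obtain m where m: "mdeg k = mdeg s + m"
      by (metis le_iff_add)
    have "cmod (v k s) \<le> M\<^sub>1 / a ^ m"
      using v[OF s] True m by simp
    also have "\<dots> \<le> M\<^sub>1 / r ^ m"
      using assms r by (intro divide_left_mono power_mono mult_pos_pos) auto
    finally have "cmod (v k s) * cmod (D (s + l)) \<le>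
        (M\<^sub>1 / r ^ m) * (M\<^sub>0 / r powr (real (mdeg s + mdeg l) + e))"
      using decay[of "s + l"] True assms r by (intro mult_mono) (auto simp: mdeg_add)
    also have "\<dots> = M\<^sub>1 * Q"
      using r by (simp add: Q_def m powr_add powr_realpow[symmetric] mult_ac)
    finally show ?thesis
      using True by (simp add: norm_mult)
  next
    case False
    then show ?thesis
      using v_eq_0[OF k s] Q assms(5) by (cases "mdeg k < mdeg s") auto
  qed
  have "cmod (\<Sum>s\<in>S. of_bool (p < mdeg s + mdeg l) * (v k s * D (s + l))) \<le> of_nat (card S) * (M\<^sub>1 * Q)"
    by (rule sum_norm_bound) (rule s_bound)
  then have "cmod (D (k + l) - (\<Sum>s\<in>S. of_bool (p < mdeg s + mdeg l) * (v k s * D (s + l))))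
      \<le> (1 + card S * M\<^sub>1) * Q"
    using k_bound norm_triangle_ineq4[of "D (k + l)" "\<Sum>s\<in>S. of_bool (p < mdeg s + mdeg l) * (v k s * D (s + l))"]
    by (simp add: algebra_simps)
  then have "cmod (A * (H * (D (k + l) - (\<Sum>s\<in>S. of_bool (p < mdeg s + mdeg l) * (v k s * D (s + l))))))
      \<le> R ^ mdeg k * (R ^ mdeg l * ((1 + card S * M\<^sub>1) * Q))"
    unfolding norm_mult using A H assms(1) by (intro mult_mono) auto
  also have "\<dots> = (1 + card S * M\<^sub>1) * (R ^ ?n * Q)"
    by (simp add: power_add mult_ac)
  also have "\<dots> \<le> (1 + card S * M\<^sub>1) * (M\<^sub>0 * (R ^ (p + 1) / (r powr (real p + e) * (r - R))))"
    unfolding Q_def using assms(1-5) kl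
    by (intro mult_left_mono geometric_decay_bound add_nonneg_nonneg mult_nonneg_nonneg) auto
  finally show ?thesis
    by (simp only: mult.assoc)
qed

lemma norm_v_le:
  assumes "a > 0" and "mdeg s \<le> mdeg k"
    and "cmod (v k s * of_real (a powi (int (mdeg k) - int (mdeg s)))) < M'"
  shows "cmod (v k s) \<le> M' / a ^ (mdeg k - mdeg s)"
proof -
  have "int (mdeg k) - int (mdeg s) = int (mdeg k - mdeg s)"
    using assms(2) by simp
  then have "cmod (v k s) * a ^ (mdeg k - mdeg s) < M'"
    using assms(1,3) by (simp add: norm_mult norm_power power_int_of_nat del: of_nat_diff)
  then show ?thesis
    using assms(1) by (simp add: pos_le_divide_eq)
qed

end

theorem theorem19:
  fixes L :: "'d::finite multi_index \<Rightarrow> complex"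
    and \<nu> :: "nat \<Rightarrow> 'd multi_index"
    and G :: "real ^ 'd \<Rightarrow> complex"
    and c p :: nat
    and a M\<^sub>0 M' p' :: real
  assumes "c \<ge> 1" and "has_order L c"
    and "graded_monomial_ordering \<nu>"
    and "p \<ge> c"
    and "Ck_on (2 * p) G (UNIV - {0})"
    and "\<And>x. x \<noteq> 0 \<Longrightarrow> diff_op L c G x = 0"
    and "a > 0" and "M\<^sub>0 > 0" and "p' \<ge> - real p"
    and "\<And>q x. \<lbrakk>0 < norm x; norm x \<le> a; mdeg q \<ge> p + 1\<rbrakk> \<Longrightarrow>
           multi_deriv_exists_at q G x \<and>
           cmod (multi_deriv q G x) \<le> M\<^sub>0 / norm x powr (real (mdeg q) + p')"
    and "\<And>k s. \<lbrakk>k \<in> multi_indices p; s \<in> \<nu> ` j_set L c \<nu> p\<rbrakk> \<Longrightarrow>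
           cmod (v_coeff L c \<nu> p k s * of_real (a powi (int (mdeg k) - int (mdeg s)))) < M'"
  shows "\<exists>A'' :: real. \<forall>c\<^sub>1 c\<^sub>2 y :: real ^ 'd. \<forall>R\<^sub>1 R\<^sub>2 :: real.
    R\<^sub>1 > 0 \<longrightarrow> R\<^sub>2 > 0 \<longrightarrow> norm (y - c\<^sub>1) < R\<^sub>1 \<longrightarrow> R\<^sub>2 \<ge> R\<^sub>1 + norm (c\<^sub>2 - c\<^sub>1) \<longrightarrow>
    (let h = c\<^sub>2 - c\<^sub>1;
         \<alpha> = multipole \<nu> y c\<^sub>1;
         \<beta> = compress L c \<nu> p \<alpha>;
         \<rho> = translate \<nu> p h \<alpha>;
         \<sigma> = translate \<nu> p h (embed_coeffs L c \<nu> p \<beta>)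
     in \<forall>x. R\<^sub>2 < norm (x - c\<^sub>2) \<and> norm (x - c\<^sub>2) \<le> a \<longrightarrow>
       cmod ((\<Sum>n = 1..multi_count TYPE('d) p. \<sigma> n * multi_deriv (\<nu> n) G (x - c\<^sub>2))
           - (\<Sum>n = 1..multi_count TYPE('d) p. \<rho> n * multi_deriv (\<nu> n) G (x - c\<^sub>2)))
       \<le> A'' * R\<^sub>2 ^ (p + 1)
           / (norm (x - c\<^sub>2) powr (real p + p') * (norm (x - c\<^sub>2) - R\<^sub>2)))"
proof -
  interpret compression \<nu> L c p
    using assms(2-4) by unfold_locales
  \<comment> \<open>\<open>E\<close> bounds the contribution of one pair \<open>(k, l)\<close> and there are at most \<open>(card I)\<^sup>2\<close> pairs. The
    maximum with 0 provides a nonnegative constant also when there is no \<open>s\<close>, in which case nothing is known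
    about \<open>M'\<close>.\<close>
  define E where "E = (1 + card S * max 0 M') * M\<^sub>0"
  define I where "I = (multi_indices p :: 'd multi_index set)"
  have E: "0 \<le> E"
    using assms(8) by (auto simp: E_def intro!: mult_nonneg_nonneg add_nonneg_nonneg)
  have bound: "cmod ((\<Sum>n = 1..multi_count TYPE('d) p.
             translate \<nu> p (c\<^sub>2 - c\<^sub>1) (embed_coeffs L c \<nu> p (compress L c \<nu> p (multipole \<nu> y c\<^sub>1))) n
               * multi_deriv (\<nu> n) G (x - c\<^sub>2))
           - (\<Sum>n = 1..multi_count TYPE('d) p.
             translate \<nu> p (c\<^sub>2 - c\<^sub>1) (multipole \<nu> y c\<^sub>1) n * multi_deriv (\<nu> n) G (x - c\<^sub>2)))
       \<le> real (card I) * (real (card I) * E) * R\<^sub>2 ^ (p + 1)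
           / (norm (x - c\<^sub>2) powr (real p + p') * (norm (x - c\<^sub>2) - R\<^sub>2))"
    (is "cmod (?\<sigma> - ?\<rho>) \<le> _")
    if R: "R\<^sub>1 > 0" "R\<^sub>2 > 0" "norm (y - c\<^sub>1) < R\<^sub>1" "R\<^sub>2 \<ge> R\<^sub>1 + norm (c\<^sub>2 - c\<^sub>1)"
      and x: "R\<^sub>2 < norm (x - c\<^sub>2)" "norm (x - c\<^sub>2) \<le> a"
    for c\<^sub>1 c\<^sub>2 y x :: "real ^ 'd" and R\<^sub>1 R\<^sub>2 :: real
  proof -
    define z where "z = x - c\<^sub>2"
    define h where "h = c\<^sub>2 - c\<^sub>1"
    define D where "D = (\<lambda>q. multi_deriv q G z)"
    define A where "A = taylor_weight (c\<^sub>1 - y)"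
    define K where "K = R\<^sub>2 ^ (p + 1) / (norm z powr (real p + p') * (norm z - R\<^sub>2))"
    let ?T = "truncated_taylor p h D"
    have z: "z \<noteq> 0" "R\<^sub>2 < norm z" "norm z \<le> a"
      using x R by (auto simp: z_def)
    have K: "0 \<le> K"
      using z R by (simp add: K_def)
    have rel: "D (k + l) = (\<Sum>s\<in>S. v k s * D (s + l))" if "k \<in> I" "l \<in> I" for k l
      unfolding D_def using that z(1) assms(6)
      by (intro multi_deriv_decompress[OF assms(5)]) (auto simp: I_def)
    have alpha: "multipole \<nu> y c\<^sub>1 i = A (\<nu> i)" for i
      by (simp add: multipole_def A_def taylor_weight_def)
    have "?\<sigma> - ?\<rho> = (\<Sum>i = 1..multi_count TYPE('d) p. A (\<nu> i) * ((\<Sum>s\<in>S. v (\<nu> i) s * ?T s) - ?T (\<nu> i)))"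
      unfolding z_def[symmetric] h_def[symmetric] sum_translate[of p h _ D, unfolded D_def, folded D_def]
        sum_embed_compress
      by (simp add: alpha right_diff_distrib sum_subtractf)
    also have "\<dots> = (\<Sum>k\<in>I. A k * ((\<Sum>s\<in>S. v k s * ?T s) - ?T k))"
      unfolding I_def by (rule sum_nu)
    also have "cmod \<dots> \<le> real (card I) * (real (card I) * (E * K))"
    proof (rule sum_norm_bound)
      fix k assume k: "k \<in> I"
      have "cmod (A k * (\<Sum>l\<in>I. of_bool (p < mdeg k + mdeg l) * (taylor_weight h l *
          (D (k + l) - (\<Sum>s\<in>S. of_bool (p < mdeg s + mdeg l) * (v k s * D (s + l)))))))
        \<le> real (card I) * (E * K)"
        unfolding sum_distrib_left
      proof (rule sum_norm_bound)
        fix l assume l: "l \<in> I"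
        show "cmod (A k * (of_bool (p < mdeg k + mdeg l) * (taylor_weight h l *
          (D (k + l) - (\<Sum>s\<in>S. of_bool (p < mdeg s + mdeg l) * (v k s * D (s + l))))))) \<le> E * K"
        proof (cases "p < mdeg k + mdeg l")
          case True
          have "cmod (A k * (taylor_weight h l *
            (D (k + l) - (\<Sum>s\<in>S. of_bool (p < mdeg s + mdeg l) * (v k s * D (s + l)))))) \<le> E * K"
            unfolding E_def K_def
          proof (rule defect_term_bound)
            show "cmod (A k) \<le> R\<^sub>2 ^ mdeg k"
              unfolding A_def
            proof (rule norm_taylor_weight_le)
              show "norm (c\<^sub>1 - y) \<le> R\<^sub>2"
                using R norm_ge_zero[of "c\<^sub>2 - c\<^sub>1"] norm_minus_commute[of y c\<^sub>1] by linarith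
            qed
            show "cmod (taylor_weight h l) \<le> R\<^sub>2 ^ mdeg l"
              unfolding h_def using R by (intro norm_taylor_weight_le) simp
            show "cmod (D q) \<le> M\<^sub>0 / norm z powr (real (mdeg q) + p')" if "p < mdeg q" for q
              using assms(10)[of z q] z that by (simp add: D_def)
            show "cmod (v k s) \<le> max 0 M' / a ^ (mdeg k - mdeg s)"
              if "s \<in> S" "mdeg s \<le> mdeg k" for s
            proof -
              have "cmod (v k s * of_real (a powi (int (mdeg k) - int (mdeg s)))) < max 0 M'"
                using assms(11)[of k s] that(1) k by (simp add: I_def less_max_iff_disj)
              from norm_v_le[OF assms(7) that(2) this] show ?thesis .
            qed
          qed (use R z k True assms(8) in \<open>auto simp: I_def\<close>)
          with True show ?thesis by simp
        qed (use E K in simp)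
      qed
      then show "cmod (A k * ((\<Sum>s\<in>S. v k s * ?T s) - ?T k)) \<le> real (card I) * (E * K)"
        using taylor_defect[of D k h] rel k by (simp add: I_def)
    qed
    finally show ?thesis
      by (simp add: K_def z_def mult_ac)
  qed
  show ?thesis
    unfolding Let_def
    by (rule exI[of _ "real (card I) * (real (card I) * E)"]) (use bound in blast)
qed

end
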